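(* Let $L_n$ be the length of a random source-to-sink path in a random series-parallel network of size $n$ generated by the binary model, and let $\tilde\phi=\frac{\sqrt5-1}{2}$. Then, as $n\to\infty$, $$\frac{L_n}{n^{\tilde\phi}}\xrightarrow{(d)}L,$$ where $L$ is determined by its integer moments $$\mathbb{E}(L^r)=\frac{r!\,\tilde c_r}{\Gamma(r\tilde\phi+1)},\qquad r\ge0,$$ with $\tilde c_0=1$, $\tilde c_1=\frac{3+\tilde\phi}{5}$, and for $r\ge2$ $$\tilde c_r=\frac{1}{\tilde\phi(r-1)\big((r+1)\tilde\phi+1\big)}\sum_{k=1}^{r-1}(k\tilde\phi+1)\tilde c_k\tilde c_{r-k}.$$
   Context: Binary (uniform binary saturation) model of series-parallel networks: directed graphs with a source and a sink, edges oriented towards the sink. At step $1$ the network is a single edge from the source to the sink. At step $n>1$ one of the $n-1$ edges $(x,y)$ is chosen uniformly at random. If $x$ has out-degree $1$, a new parallel edge $(x,y)$ is added; if $x$ has out-degree $2$, $(x,y)$ is replaced by $(x,z),(z,y)$ with $z$ a new vertex. The network after step $n$ has size $n$ ($n$ edges). A random source-to-sink path starts at the source and at each vertex follows one of its outgoing edges chosen uniformly at random until it reaches the sink; its length is its number of edges. *)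

theory Defs
  imports "HOL-Probability.Probability"
begin

text \<open>Series-parallel networks in the binary model.  Vertices are natural numbers,
  the source is 0 and the sink is 1.  A network is represented by its list of
  (directed) edges together with the next fresh vertex label.  Parallel edges
  are separate list entries.\<close>

type_synonym spnet = "(nat \<times> nat) list \<times> nat"

definition sp_source :: nat where "sp_source = 0"
definition sp_sink :: nat where "sp_sink = 1"

definition sp_init :: spnet where "sp_init = ([(sp_source, sp_sink)], 2)"

definition outdeg :: "(nat \<times> nat) list \<Rightarrow> nat \<Rightarrow> nat" where
  "outdeg es x = length (filter (\<lambda>e. fst e = x) es)"

definition sp_update :: "spnet \<Rightarrow> nat \<Rightarrow> spnet" where
  "sp_update N i = (let es = fst N; z = snd N; (x, y) = es ! i in
      if outdeg es x = 1 then (es @ [(x, y)], z)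
      else (es[i := (x, z)] @ [(z, y)], Suc z))"

definition sp_step :: "spnet \<Rightarrow> spnet pmf" where
  "sp_step N = map_pmf (sp_update N) (pmf_of_set {..<length (fst N)})"

text \<open>Random network of size n (n edges) for n \<ge> 1; for n = 0 we also return
  the initial network (irrelevant for the asymptotic statement).\<close>
definition sp_net :: "nat \<Rightarrow> spnet pmf" where
  "sp_net n = ((\<lambda>p. bind_pmf p sp_step) ^^ (n - 1)) (return_pmf sp_init)"

text \<open>Random source-to-sink walk: at each vertex follow one of its outgoing edges
  chosen uniformly at random, until the sink is reached.  The fuel argument
  only ensures termination; with fuel = number of edges it is never exhausted
  in an acyclic network.  The result is the number of edges traversed.\<close>
fun sp_walk :: "(nat \<times> nat) list \<Rightarrow> nat \<Rightarrow> nat \<Rightarrow> nat pmf" where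
  "sp_walk es 0 v = return_pmf 0"
| "sp_walk es (Suc k) v =
     (let outs = filter (\<lambda>e. fst e = v) es in
      if v = sp_sink \<or> outs = [] then return_pmf 0
      else bind_pmf (pmf_of_set {..<length outs})
             (\<lambda>j. map_pmf Suc (sp_walk es k (snd (outs ! j)))))"

definition path_len :: "nat \<Rightarrow> nat pmf" where
  "path_len n = bind_pmf (sp_net n) (\<lambda>N. sp_walk (fst N) (length (fst N)) sp_source)"

definition phi_t :: real where "phi_t = (sqrt 5 - 1) / 2"

end

theory Submission
  imports Defs
begin

text \<open>
  Call an edge of type A if its tail has out-degree one and of type B otherwise. A chosen A-edge
  becomes two parallel B-edges, and a chosen B-edge becomes a B-edge followed by an A-edge. Hence the
  numbers \<open>(a, b)\<close> of A- and B-edges on the random path form a Markov chain on their own: given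
  \<open>n\<close> edges, it moves to \<open>(a - 1, b + 1)\<close> with probability \<open>a / n\<close> and to \<open>(a + 1, b)\<close> with
  probability \<open>b / n\<close>. Put \<open>A(s) = \<Sum> c\<^sub>r s\<^sup>r\<close> and \<open>B(s) = \<Sum> (r \<phi> + 1) c\<^sub>r s\<^sup>r\<close>. The recursion
  for \<open>c\<close> says \<open>\<phi> s A' = B - A\<close> and \<open>\<phi> s B' = B (A - 1)\<close>, which makes the coefficient of \<open>s\<^sup>r\<close> in
  \<open>A\<^sup>a B\<^sup>b\<close> an eigenfunction of the chain, with expectation \<open>c\<^sub>r \<Prod>\<^sub>k\<^sub><\<^sub>n (1 + r \<phi> / k)\<close>. Its leading
  part is \<open>x\<^sup>r / r!\<close> with \<open>x\<close> linear in \<open>(a, b)\<close>, so all moments of \<open>x / n\<^sup>\<phi>\<close> converge.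
  The difference of \<open>x\<close> and \<open>a + b\<close> is a multiple of the other linear eigenfunction, whose second
  moment is only \<open>O(n)\<close>, and \<open>\<phi> > 1 / 2\<close>. The moments grow slowly enough to determine the law.
\<close>

section \<open>The method of moments\<close>

text \<open>Chebyshev's inequality bounds the mass outside \<open>{-t<..t}\<close> by
  \<open>B / t ^ 2\<close>, uniformly in \<open>n\<close>.\<close>

lemma tight_of_second_moment:
  fixes \<mu> :: "nat \<Rightarrow> real measure"
  assumes rd: "\<And>n. real_distribution (\<mu> n)"
    and int: "\<And>n. integrable (\<mu> n) (\<lambda>x. x ^ 2)"
    and bd: "\<And>n. (\<integral>x. x ^ 2 \<partial>\<mu> n) \<le> B"
  shows "tight \<mu>"
  unfolding tight_def
proof (intro conjI allI impI)
  fix e :: real assume e: "e > 0"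
  \<comment> \<open>This choice gives \<open>B < e * t\<close>, and \<open>t \<ge> 1\<close> then
    allows \<open>t\<close> to be replaced by its square.\<close>
  define t where "t = 1 + \<bar>B\<bar> / e"
  have t1: "t \<ge> 1" using e by (simp add: t_def)
  have "e * t = e + \<bar>B\<bar>" using e by (simp add: t_def field_simps)
  then have "B < e * t" using e by linarith
  also have "\<dots> \<le> e * t ^ 2" using e t1 by (intro mult_left_mono) (simp_all add: self_le_power)
  finally have t: "B / t ^ 2 < e" "t > 0" using t1 by (simp_all add: field_simps)
  show "\<exists>a b. a < b \<and> (\<forall>n. 1 - e < measure (\<mu> n) {a<..b})"
  proof (rule exI[of _ "-t"], rule exI[of _ t], intro conjI allI)
    fix n
    interpret real_distribution "\<mu> n" by (rule rd)
    have "prob (space (\<mu> n) - {-t<..t}) \<le> prob {x \<in> space (\<mu> n). t ^ 2 \<le> x ^ 2}"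
    proof (intro finite_measure_mono subsetI)
      fix x assume "x \<in> space (\<mu> n) - {- t<..t}"
      then have "\<bar>t\<bar> \<le> \<bar>x\<bar>" using t by auto
      then show "x \<in> {x \<in> space (\<mu> n). t ^ 2 \<le> x ^ 2}" by (simp only: abs_le_square_iff) simp
    qed auto
    also have "\<dots> \<le> (\<integral>x. x ^ 2 \<partial>\<mu> n) / t ^ 2"
      using t by (intro integral_Markov_inequality_measure[OF int, of "{}"]) auto
    also have "\<dots> \<le> B / t ^ 2" using bd t by (intro divide_right_mono) auto
    finally have "prob (space (\<mu> n) - {-t<..t}) < e" using t by simp
    then show "1 - e < prob {-t<..t}" by (subst (asm) prob_compl) auto
  qed (use t in auto)
qed (rule rd)

text \<open>Weak convergence only transfers bounded continuous integrands. The power is therefore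
  truncated at \<open>K\<close>, the bound \<open>B\<close> passes to the limit in \<open>n\<close>
  for each fixed \<open>K\<close>, and monotone convergence removes the truncation.\<close>

lemma weak_limit_even_moment:
  fixes \<mu> :: "nat \<Rightarrow> real measure"
  assumes rd: "\<And>n. real_distribution (\<mu> n)" "real_distribution M" and wc: "weak_conv_m \<mu> M"
    and int: "\<And>n. integrable (\<mu> n) (\<lambda>x. x ^ (2 * r))"
    and bd: "\<And>n. (\<integral>x. x ^ (2 * r) \<partial>\<mu> n) \<le> B"
  shows "integrable M (\<lambda>x. x ^ (2 * r))" "(\<integral>x. x ^ (2 * r) \<partial>M) \<le> B"
proof -
  interpret M: real_distribution M by (rule rd)
  have pos: "0 \<le> x ^ (2 * r)" for x :: real by (simp add: zero_le_even_power)
  have "(\<integral>x. x ^ (2 * r) \<partial>\<mu> 0) \<ge> 0" by (intro integral_nonneg_AE) (simp add: pos)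
  then have B0: "0 \<le> B" using bd[of 0] by linarith
  have trunc: "(\<integral>x. min (x ^ (2 * r)) K \<partial>M) \<le> B" if "K \<ge> 0" for K :: real
  proof (rule LIMSEQ_le_const2)
    show "(\<lambda>n. \<integral>x. min (x ^ (2 * r)) K \<partial>\<mu> n) \<longlonglongrightarrow> (\<integral>x. min (x ^ (2 * r)) K \<partial>M)"
      using pos that by (intro weak_conv_imp_integral_bdd_continuous_conv[OF rd wc, of _ K])
        (auto simp: abs_if min_less_iff_disj not_less intro!: continuous_intros)
    have "(\<integral>x. min (x ^ (2 * r)) K \<partial>\<mu> n) \<le> (\<integral>x. x ^ (2 * r) \<partial>\<mu> n)" for n
    proof -
      interpret real_distribution "\<mu> n" by (rule rd)
      show ?thesis using int pos that
        by (intro integral_mono Bochner_Integration.integrable_bound[OF int[of n]]) auto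
    qed
    then show "\<exists>N. \<forall>n\<ge>N. (\<integral>x. min (x ^ (2 * r)) K \<partial>\<mu> n) \<le> B" using bd by (meson order_trans)
  qed
  have "(\<integral>\<^sup>+ x. ennreal (x ^ (2 * r)) \<partial>M) = (\<integral>\<^sup>+ x. (SUP k::nat. ennreal (min (x ^ (2 * r)) k)) \<partial>M)"
  proof (intro nn_integral_cong)
    fix x :: real
    obtain k :: nat where k: "x ^ (2 * r) \<le> k" using real_arch_simple by blast
    show "ennreal (x ^ (2 * r)) = (SUP k::nat. ennreal (min (x ^ (2 * r)) k))"
    proof (intro antisym SUP_least)
      have "ennreal (x ^ (2 * r)) = ennreal (min (x ^ (2 * r)) k)" using k by simp
      also have "\<dots> \<le> (SUP k::nat. ennreal (min (x ^ (2 * r)) k))" by (rule SUP_upper) simp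
      finally show "ennreal (x ^ (2 * r)) \<le> (SUP k::nat. ennreal (min (x ^ (2 * r)) k))" .
    qed (auto intro: ennreal_leI)
  qed
  also have "\<dots> = (SUP k::nat. \<integral>\<^sup>+ x. ennreal (min (x ^ (2 * r)) k) \<partial>M)"
    by (intro nn_integral_monotone_convergence_SUP)
      (auto simp: incseq_def le_fun_def intro!: ennreal_leI)
  also have "\<dots> \<le> ennreal B"
  proof (intro SUP_least)
    fix k :: nat
    have "integrable M (\<lambda>x. min (x ^ (2 * r)) (real k))"
      by (intro M.integrable_const_bound[of _ k]) (auto simp: pos)
    then have "(\<integral>\<^sup>+ x. ennreal (min (x ^ (2 * r)) k) \<partial>M) = ennreal (\<integral>x. min (x ^ (2 * r)) k \<partial>M)"
      by (intro nn_integral_eq_integral) (auto simp: pos)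
    also have "\<dots> \<le> ennreal B" using trunc[of k] by (intro ennreal_leI) simp
    finally show "(\<integral>\<^sup>+ x. ennreal (min (x ^ (2 * r)) k) \<partial>M) \<le> ennreal B" .
  qed
  finally have nn: "(\<integral>\<^sup>+ x. ennreal (x ^ (2 * r)) \<partial>M) \<le> ennreal B" .
  show i: "integrable M (\<lambda>x. x ^ (2 * r))"
    using nn by (intro integrableI_nonneg) (auto simp: pos intro: le_less_trans)
  show "(\<integral>x. x ^ (2 * r) \<partial>M) \<le> B"
    using nn nn_integral_eq_integral[OF i] pos B0 by (simp add: ennreal_le_iff)
qed

definition clip :: "real \<Rightarrow> real \<Rightarrow> real" where "clip K x = max (- K) (min K x)"

text \<open>The difference vanishes for \<open>\<bar>x\<bar> \<le> K\<close>. Beyond that both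
  powers are at most \<open>\<bar>x\<bar> ^ r\<close>, and one factor
  \<open>(\<bar>x\<bar> / K) ^ r \<ge> 1\<close> is spent to reach order \<open>2 * r\<close>. This
  controls the error of clipping by a moment of twice the order.\<close>

lemma clip_power_diff:
  assumes "K > 0"
  shows "\<bar>x ^ r - clip K x ^ r\<bar> \<le> 2 * x ^ (2 * r) / K ^ r"
proof (cases "\<bar>x\<bar> \<le> K")
  case True
  then have "clip K x = x" by (auto simp: clip_def)
  then show ?thesis using assms by (simp add: zero_le_even_power)
next
  case False
  have c: "\<bar>clip K x\<bar> \<le> \<bar>x\<bar>" using False assms by (auto simp: clip_def)
  have "\<bar>x ^ r - clip K x ^ r\<bar> \<le> \<bar>x\<bar> ^ r + \<bar>clip K x\<bar> ^ r"
    using abs_triangle_ineq4[of "x ^ r" "clip K x ^ r"] by (simp add: power_abs)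
  also have "\<dots> \<le> 2 * \<bar>x\<bar> ^ r" using c by (simp add: power_mono)
  also have "\<dots> \<le> 2 * x ^ (2 * r) / K ^ r"
  proof -
    have "\<bar>x\<bar> ^ r * K ^ r \<le> \<bar>x\<bar> ^ r * \<bar>x\<bar> ^ r"
      using False assms by (intro mult_left_mono power_mono) auto
    also have "\<dots> = x ^ (2 * r)"
      by (simp add: power_add[symmetric] mult_2[symmetric] power_even_abs)
    finally show ?thesis using assms by (simp add: field_simps)
  qed
  finally show ?thesis .
qed

text \<open>The moments of order \<open>2 * r\<close> converge, hence are bounded, which makes the
  error of clipping \<open>x ^ r\<close> uniformly small. The clipped powers are bounded and
  continuous, so their integrals converge.\<close>

lemma weak_limit_moment:
  fixes \<mu> :: "nat \<Rightarrow> real measure"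
  assumes rd: "\<And>n. real_distribution (\<mu> n)" "real_distribution M" and wc: "weak_conv_m \<mu> M"
    and int: "\<And>n r. integrable (\<mu> n) (\<lambda>x. x ^ r)"
    and lim: "\<And>r. (\<lambda>n. \<integral>x. x ^ r \<partial>\<mu> n) \<longlonglongrightarrow> m r"
  shows "integrable M (\<lambda>x. x ^ r) \<and> (\<integral>x. x ^ r \<partial>M) = m r"
proof (cases "r = 0")
  \<comment> \<open>At exponent 0 the error \<open>4 * B / K ^ r\<close> does not vanish as
    \<open>K\<close> grows, so the total mass is treated directly.\<close>
  case True
  interpret M: real_distribution M by (rule rd)
  have "(\<lambda>n. 1) \<longlonglongrightarrow> m 0"
    using lim[of 0] real_distribution.axioms(1)[OF rd(1)] by (simp add: prob_space.prob_space)
  then have "m 0 = 1" by (simp add: LIMSEQ_const_iff)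
  then show ?thesis using True M.prob_space by simp
next
  case r0: False
  interpret M: real_distribution M by (rule rd)
  have "Bseq (\<lambda>n. \<integral>x. x ^ (2 * r) \<partial>\<mu> n)"
    using lim[of "2 * r"] by (intro convergent_imp_Bseq convergentI)
  then obtain B where B: "\<And>n. \<bar>\<integral>x. x ^ (2 * r) \<partial>\<mu> n\<bar> \<le> B" "B > 0"
    by (auto simp: Bseq_def)
  have B': "(\<integral>x. x ^ (2 * r) \<partial>\<mu> n) \<le> B" for n using B(1)[of n] by linarith
  note even = weak_limit_even_moment[OF rd wc int B']
  have i: "integrable M (\<lambda>x. x ^ r)"
  proof (rule Bochner_Integration.integrable_bound)
    show "integrable M (\<lambda>x. 1 + x ^ (2 * r))" using even by auto
    have "\<bar>x\<bar> ^ r \<le> 1 + x ^ (2 * r)" for x :: real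
    proof -
      have "0 \<le> (\<bar>x\<bar> ^ r - 1)\<^sup>2" by simp
      moreover have "(\<bar>x\<bar> ^ r)\<^sup>2 = x ^ (2 * r)" by (simp add: power_mult[symmetric] mult.commute power_even_abs)
      moreover have "0 \<le> \<bar>x\<bar> ^ r" by simp
      ultimately show ?thesis unfolding power2_diff one_power2 mult_1_right by linarith
    qed
    then show "AE x in M. norm (x ^ r) \<le> norm (1 + x ^ (2 * r))"
      by (intro AE_I2) (simp add: power_abs zero_le_even_power)
  qed auto
  have clip: "\<bar>(\<integral>x. x ^ r \<partial>\<nu>) - (\<integral>x. clip K x ^ r \<partial>\<nu>)\<bar> \<le> 2 * B / K ^ r"
    if "K > 0" "real_distribution \<nu>" "integrable \<nu> (\<lambda>x. x ^ r)" "integrable \<nu> (\<lambda>x. x ^ (2 * r))"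
      "(\<integral>x. x ^ (2 * r) \<partial>\<nu>) \<le> B" for \<nu> and K :: real
  proof -
    interpret real_distribution \<nu> by (rule that)
    have [measurable]: "clip K \<in> borel_measurable borel" unfolding clip_def by measurable
    have "\<bar>clip K x\<bar> \<le> K" for x using that(1) by (auto simp: clip_def)
    then have ic: "integrable \<nu> (\<lambda>x. clip K x ^ r)"
      by (intro integrable_const_bound[of _ "K ^ r"]) (auto simp: power_abs power_mono)
    have "\<bar>(\<integral>x. x ^ r \<partial>\<nu>) - (\<integral>x. clip K x ^ r \<partial>\<nu>)\<bar> = \<bar>\<integral>x. x ^ r - clip K x ^ r \<partial>\<nu>\<bar>"
      using that ic by simp
    also have "\<dots> \<le> (\<integral>x. \<bar>x ^ r - clip K x ^ r\<bar> \<partial>\<nu>)" by (rule integral_abs_bound)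
    also have "\<dots> \<le> (\<integral>x. 2 * x ^ (2 * r) / K ^ r \<partial>\<nu>)"
      using that ic clip_power_diff[OF that(1)] by (intro integral_mono) auto
    also have "\<dots> = 2 * (\<integral>x. x ^ (2 * r) \<partial>\<nu>) / K ^ r" by simp
    also have "\<dots> \<le> 2 * B / K ^ r" using that by (intro divide_right_mono) auto
    finally show ?thesis .
  qed
  \<comment> \<open>Both \<open>M\<close> and \<open>\<mu> n\<close> contribute a clipping error
    \<open>2 * B / K ^ r\<close>; the remaining two differences tend to 0 as \<open>n\<close> grows
    with \<open>K\<close> fixed.\<close>
  have bound: "\<bar>(\<integral>x. x ^ r \<partial>M) - m r\<bar> \<le> 4 * B / K ^ r" if K: "K > 0" for K :: real
  proof (rule LIMSEQ_le_const)
    have "(\<lambda>n. \<integral>x. clip K x ^ r \<partial>\<mu> n) \<longlonglongrightarrow> (\<integral>x. clip K x ^ r \<partial>M)"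
    proof (rule weak_conv_imp_integral_bdd_continuous_conv[OF rd wc])
      show "isCont (\<lambda>x. clip K x ^ r) x" for x unfolding clip_def by (intro continuous_intros)
      have "\<bar>clip K x\<bar> \<le> K" for x using K by (auto simp: clip_def)
      then show "norm (clip K x ^ r) \<le> K ^ r" for x by (simp add: power_abs power_mono)
    qed
    then show "(\<lambda>n. 4 * B / K ^ r + \<bar>(\<integral>x. clip K x ^ r \<partial>M) - (\<integral>x. clip K x ^ r \<partial>\<mu> n)\<bar> 
         + \<bar>(\<integral>x. x ^ r \<partial>\<mu> n) - m r\<bar>) \<longlonglongrightarrow> 4 * B / K ^ r"
      by (auto intro!: tendsto_eq_intros lim)
    have "\<bar>(\<integral>x. x ^ r \<partial>M) - m r\<bar> \<le> 4 * B / K ^ r + 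
         \<bar>(\<integral>x. clip K x ^ r \<partial>M) - (\<integral>x. clip K x ^ r \<partial>\<mu> n)\<bar> + \<bar>(\<integral>x. x ^ r \<partial>\<mu> n) - m r\<bar>" for n
      using clip[OF K rd(2) i even] clip[OF K rd(1)[of n] int int B'] by simp
    then show "\<exists>N. \<forall>n\<ge>N. \<bar>(\<integral>x. x ^ r \<partial>M) - m r\<bar> \<le> 4 * B / K ^ r + 
         \<bar>(\<integral>x. clip K x ^ r \<partial>M) - (\<integral>x. clip K x ^ r \<partial>\<mu> n)\<bar> + \<bar>(\<integral>x. x ^ r \<partial>\<mu> n) - m r\<bar>" by blast
  qed
  have "((\<lambda>K. 4 * B / K ^ r) \<longlongrightarrow> 0) at_top"
    using r0 by (intro real_tendsto_divide_at_top[OF tendsto_const] filterlim_pow_at_top filterlim_ident) auto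
  then have "\<bar>(\<integral>x. x ^ r \<partial>M) - m r\<bar> \<le> 0"
    by (rule tendsto_lowerbound)
      (auto intro: eventually_mono[OF eventually_gt_at_top[of 0]] bound)
  then show ?thesis using i by simp
qed


section \<open>Moments and characteristic functions\<close>

text \<open>The Taylor polynomials of degree \<open>2 * N\<close> of the two characteristic
  functions differ only through the moments. The even degree turns the absolute moment in the
  remainder bound into an ordinary moment.\<close>

lemma char_diff_le_moments:
  assumes "real_distribution M1" "real_distribution M2"
    and int: "\<And>r. integrable M1 (\<lambda>x. x ^ r)" "\<And>r. integrable M2 (\<lambda>x. x ^ r)"
  shows "cmod (char M1 t - char M2 t) \<le>
    (\<Sum>k\<le>2 * N. \<bar>t\<bar> ^ k / fact k * \<bar>(\<integral>x. x ^ k \<partial>M1) - (\<integral>x. x ^ k \<partial>M2)\<bar>) +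
    2 * \<bar>t\<bar> ^ (2 * N) / fact (2 * N) * ((\<integral>x. x ^ (2 * N) \<partial>M1) + (\<integral>x. x ^ (2 * N) \<partial>M2))"
proof -
  define P where "P M = (\<Sum>k\<le>2 * N. (\<i> * t) ^ k / fact k * complex_of_real (\<integral>x. x ^ k \<partial>M))" for M
  define R where "R M = 2 * \<bar>t\<bar> ^ (2 * N) / fact (2 * N) * (\<integral>x. x ^ (2 * N) \<partial>M)" for M :: "real measure"
  have approx: "cmod (char M t - P M) \<le> R M"
    if "real_distribution M" "\<And>r. integrable M (\<lambda>x. x ^ r)" for M
    using real_distribution.char_approx1[OF that(1), of "2 * N" t] that(2)
    unfolding P_def R_def by (simp add: power_even_abs)
  have "P M1 - P M2 = (\<Sum>k\<le>2 * N. (\<i> * t) ^ k / fact k *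
      complex_of_real ((\<integral>x. x ^ k \<partial>M1) - (\<integral>x. x ^ k \<partial>M2)))"
    by (simp add: P_def sum_subtractf ring_distribs)
  also have "cmod \<dots> \<le> (\<Sum>k\<le>2 * N. cmod ((\<i> * t) ^ k / fact k *
      complex_of_real ((\<integral>x. x ^ k \<partial>M1) - (\<integral>x. x ^ k \<partial>M2))))" by (rule norm_sum)
  also have "\<dots> = (\<Sum>k\<le>2 * N. \<bar>t\<bar> ^ k / fact k * \<bar>(\<integral>x. x ^ k \<partial>M1) - (\<integral>x. x ^ k \<partial>M2)\<bar>)"
    unfolding norm_mult norm_divide norm_power norm_of_real norm_fact by simp
  finally have P: "cmod (P M1 - P M2) \<le> \<dots>" .
  have "char M1 t - char M2 t = (char M1 t - P M1) + (P M1 - P M2) - (char M2 t - P M2)" by simp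
  also have "cmod \<dots> \<le> cmod (char M1 t - P M1) + cmod (P M1 - P M2) + cmod (char M2 t - P M2)"
    by (meson norm_triangle_ineq norm_triangle_ineq4 order_trans add_right_mono)
  finally show ?thesis
    using P approx[OF assms(1) int(1)] approx[OF assms(2) int(2)] unfolding R_def distrib_left by linarith
qed

text \<open>With equal moments only the Taylor remainders survive. As \<open>small\<close> holds at
  every \<open>t\<close>, they vanish on the whole line at once, without continuation from a
  neighbourhood of 0.\<close>

lemma moment_determinate:
  assumes rd: "real_distribution M1" "real_distribution M2"
    and int: "\<And>r. integrable M1 (\<lambda>x. x ^ r)" "\<And>r. integrable M2 (\<lambda>x. x ^ r)"
    and eq: "\<And>r. (\<integral>x. x ^ r \<partial>M1) = m r" "\<And>r. (\<integral>x. x ^ r \<partial>M2) = m r"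
    and small: "\<And>t::real. (\<lambda>N. \<bar>t\<bar> ^ (2 * N) / fact (2 * N) * m (2 * N)) \<longlonglongrightarrow> 0"
  shows "M1 = M2"
proof (rule Levy_uniqueness[OF rd], rule ext)
  fix t :: real
  have lim: "(\<lambda>N. 4 * (\<bar>t\<bar> ^ (2 * N) / fact (2 * N) * m (2 * N))) \<longlonglongrightarrow> 0"
    using tendsto_mult_right_zero[OF small[of t]] by simp
  have "cmod (char M1 t - char M2 t) \<le> 4 * (\<bar>t\<bar> ^ (2 * N) / fact (2 * N) * m (2 * N))" for N
    using char_diff_le_moments[OF rd int, of t N] by (simp add: eq)
  then have "cmod (char M1 t - char M2 t) \<le> 0" by (intro LIMSEQ_le_const[OF lim]) auto
  then show "char M1 t = char M2 t" by simp
qed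

text \<open>Tightness serves only to produce a candidate \<open>M\<close> along a subsequence.
  Convergence of the full sequence follows from the Taylor comparison with \<open>M\<close>. The
  conclusion is in terms of characteristic functions because these are easily transferred to a
  nearby sequence of variables.\<close>

theorem method_of_moments:
  fixes \<mu> :: "nat \<Rightarrow> real measure"
  assumes rd: "\<And>n. real_distribution (\<mu> n)"
    and int: "\<And>n r. integrable (\<mu> n) (\<lambda>x. x ^ r)"
    and lim: "\<And>r. (\<lambda>n. \<integral>x. x ^ r \<partial>\<mu> n) \<longlonglongrightarrow> m r"
    and small: "\<And>t::real. (\<lambda>N. \<bar>t\<bar> ^ (2 * N) / fact (2 * N) * m (2 * N)) \<longlonglongrightarrow> 0"
  obtains M where "real_distribution M" "\<And>r. integrable M (\<lambda>x. x ^ r)"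
    "\<And>r. (\<integral>x. x ^ r \<partial>M) = m r" "\<And>t. (\<lambda>n. char (\<mu> n) t) \<longlonglongrightarrow> char M t"
proof -
  have "Bseq (\<lambda>n. \<integral>x. x ^ 2 \<partial>\<mu> n)" using lim[of 2] by (intro convergent_imp_Bseq convergentI)
  then obtain B where B: "\<And>n. \<bar>\<integral>x. x ^ 2 \<partial>\<mu> n\<bar> \<le> B" by (auto simp: Bseq_def)
  have "tight \<mu>" using B by (intro tight_of_second_moment[where B = B] rd int) (meson abs_le_D1)
  from tight_imp_convergent_subsubsequence[OF this strict_mono_id]
  obtain s M where s: "strict_mono s" and M: "real_distribution M" and wc: "weak_conv_m (\<mu> \<circ> s) M"
    by auto
  have mom: "integrable M (\<lambda>x. x ^ r) \<and> (\<integral>x. x ^ r \<partial>M) = m r" for r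
    using rd int LIMSEQ_subseq_LIMSEQ[OF lim s]
    by (intro weak_limit_moment[OF _ M wc]) (auto simp: o_def)
  have "(\<lambda>n. char (\<mu> n) t) \<longlonglongrightarrow> char M t" for t
  proof (rule LIMSEQ_I)
    fix e :: real assume e: "e > 0"
    have "eventually (\<lambda>N. \<bar>t\<bar> ^ (2 * N) / fact (2 * N) * m (2 * N) < e / 4) sequentially"
      using small[of t] e by (intro order_tendstoD(2)[of _ 0]) auto
    then obtain N where N: "\<bar>t\<bar> ^ (2 * N) / fact (2 * N) * m (2 * N) < e / 4"
      by (auto simp: eventually_sequentially)
    \<comment> \<open>The degree \<open>N\<close> is fixed first, so that the remainder is below
      \<open>e\<close> in the limit; the finitely many moment differences then vanish as
      \<open>n\<close> grows.\<close>
    define b where "b n = (\<Sum>k\<le>2 * N. \<bar>t\<bar> ^ k / fact k * \<bar>(\<integral>x. x ^ k \<partial>\<mu> n) - m k\<bar>) +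
      2 * \<bar>t\<bar> ^ (2 * N) / fact (2 * N) * ((\<integral>x. x ^ (2 * N) \<partial>\<mu> n) + m (2 * N))" for n
    have "b \<longlonglongrightarrow> (\<Sum>k\<le>2 * N. \<bar>t\<bar> ^ k / fact k * \<bar>m k - m k\<bar>) +
      2 * \<bar>t\<bar> ^ (2 * N) / fact (2 * N) * (m (2 * N) + m (2 * N))"
      unfolding b_def by (intro tendsto_intros lim)
    then have "b \<longlonglongrightarrow> 4 * (\<bar>t\<bar> ^ (2 * N) / fact (2 * N) * m (2 * N))" by simp
    then have "eventually (\<lambda>n. b n < e) sequentially"
      by (rule order_tendstoD(2)) (use N in linarith)
    moreover have "cmod (char (\<mu> n) t - char M t) \<le> b n" for n
      using char_diff_le_moments[OF rd[of n] M int, of t N] mom by (simp add: b_def)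
    ultimately show "\<exists>n0. \<forall>n\<ge>n0. cmod (char (\<mu> n) t - char M t) < e"
      unfolding eventually_sequentially by (meson le_less_trans)
  qed
  then show ?thesis using M mom by (intro that[of M]) auto
qed

section \<open>Edge types along the random path\<close>

text \<open>Edges are identified by position, since parallel edges are equal as pairs.\<close>

definition out_idx :: "(nat \<times> nat) list \<Rightarrow> nat \<Rightarrow> nat set" where
  "out_idx es v = {i. i < length es \<and> fst (es ! i) = v}"

text \<open>The walk of \<^const>\<open>sp_walk\<close>, recording the positions of the edges in the edge list.\<close>
fun path_walk :: "(nat \<times> nat) list \<Rightarrow> nat \<Rightarrow> nat \<Rightarrow> nat list pmf" where
  "path_walk es 0 v = return_pmf []"
| "path_walk es (Suc k) v =
     (if v = sp_sink \<or> out_idx es v = {} then return_pmf []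
      else bind_pmf (pmf_of_set (out_idx es v))
             (\<lambda>i. map_pmf ((#) i) (path_walk es k (snd (es ! i)))))"

lemma finite_out_idx [simp]: "finite (out_idx es v)"
  by (simp add: out_idx_def)

lemma out_idx_snoc:
  "out_idx (es @ [e]) v = out_idx es v \<union> (if fst e = v then {length es} else {})"
  by (auto simp: out_idx_def nth_append less_Suc_eq)

lemma out_idx_eq_set: "out_idx es v = set (filter (\<lambda>i. fst (es ! i) = v) [0..<length es])"
  by (auto simp: out_idx_def)

lemma filter_eq_map_nth:
  "filter P es = map ((!) es) (filter (\<lambda>i. P (es ! i)) [0..<length es])"
proof -
  have "filter P es = filter P (map ((!) es) [0..<length es])" by (simp add: map_nth)
  then show ?thesis by (simp add: filter_map o_def del: map_nth)
qed

lemma outdeg_eq_card: "outdeg es v = card (out_idx es v)"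
  unfolding outdeg_def out_idx_eq_set
  by (subst filter_eq_map_nth) (simp add: distinct_card del: set_filter)

lemma pmf_of_set_set_conv_nth:
  assumes "distinct xs" "xs \<noteq> []"
  shows "pmf_of_set (set xs) = map_pmf ((!) xs) (pmf_of_set {..<length xs})"
  using assms by (intro map_pmf_of_set_bij_betw[symmetric] bij_betw_nth) (auto simp: lessThan_empty_iff)

text \<open>\<open>sp_walk\<close> draws an index into the filtered list, \<open>path_walk\<close> a
  position in the full list; the increasing enumeration \<open>js\<close> of the outgoing positions
  is a bijection between the two choices.\<close>

lemma sp_walk_eq_map_path_walk: "sp_walk es k v = map_pmf length (path_walk es k v)"
proof (induction k arbitrary: v)
  case (Suc k)
  define js where "js = filter (\<lambda>i. fst (es ! i) = v) [0..<length es]"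
  have js: "distinct js" "out_idx es v = set js" "filter (\<lambda>e. fst e = v) es = map ((!) es) js"
    unfolding js_def by (simp_all add: out_idx_eq_set filter_eq_map_nth[of "\<lambda>e. fst e = v"])
  show ?case
  proof (cases "v = sp_sink \<or> js = []")
    case False
    then have "map_pmf length (path_walk es (Suc k) v) =
      bind_pmf (pmf_of_set {..<length js}) (\<lambda>j. map_pmf Suc (sp_walk es k (snd (es ! (js ! j)))))"
      using js by (simp add: pmf_of_set_set_conv_nth map_bind_pmf bind_map_pmf Suc.IH pmf.map_comp o_def)
    also have "\<dots> = sp_walk es (Suc k) v"
      using False js(3) by (auto simp: Let_def lessThan_empty_iff intro!: bind_pmf_cong)
    finally show ?thesis by simp
  qed (use js in auto)
qed simp

text \<open>A rank function certifies acyclicity, and the rank of a vertex bounds the fuel needed from it.\<close>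
definition ranked :: "(nat \<Rightarrow> nat) \<Rightarrow> (nat \<times> nat) list \<Rightarrow> bool" where
  "ranked rk es \<longleftrightarrow> (\<forall>(x, y) \<in> set es. rk y < rk x)"

lemma rankedD: "ranked rk es \<Longrightarrow> j < length es \<Longrightarrow> rk (snd (es ! j)) < rk (fst (es ! j))"
  by (metis (mono_tags, lifting) case_prod_beta nth_mem ranked_def)

text \<open>Ranks of tails drop strictly along the walk, so no position recurs. The bound by
  \<open>rk v\<close> is what carries the induction.\<close>

lemma path_walk_ranked:
  assumes "ranked rk es" "p \<in> set_pmf (path_walk es k v)"
  shows "distinct p \<and> (\<forall>j\<in>set p. j < length es \<and> rk (fst (es ! j)) \<le> rk v)"
  using assms(2)
proof (induction k arbitrary: v p)
  case (Suc k)
  show ?case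
  proof (cases "v = sp_sink \<or> out_idx es v = {}")
    case False
    then obtain i q where i: "i \<in> out_idx es v" and p: "p = i # q"
      and q: "q \<in> set_pmf (path_walk es k (snd (es ! i)))"
      using Suc.prems by auto
    from i have i': "i < length es" "fst (es ! i) = v" by (auto simp: out_idx_def)
    from rankedD[OF assms(1) i'(1)] i' have "rk (snd (es ! i)) < rk v" by simp
    with Suc.IH[OF q] i' p show ?thesis by fastforce
  qed (use Suc.prems in auto)
qed simp

definition single_out :: "(nat \<times> nat) list \<Rightarrow> nat \<Rightarrow> bool" where
  "single_out es i \<longleftrightarrow> outdeg es (fst (es ! i)) = 1"

definition type_count :: "(nat \<Rightarrow> bool) \<Rightarrow> nat list \<Rightarrow> nat \<times> nat" where
  "type_count A p = (length (filter A p), length (filter (\<lambda>j. \<not> A j) p))"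

text \<open>The effect on the counts of updating position \<open>i\<close>: an A-edge on the path
  becomes one of two parallel B-edges, a B-edge becomes a B-edge followed by an A-edge, and an
  update off the path changes nothing.\<close>

definition type_count_upd :: "(nat \<Rightarrow> bool) \<Rightarrow> nat \<Rightarrow> nat list \<Rightarrow> nat \<times> nat" where
  "type_count_upd A i p = (let (a, b) = type_count A p in
     if i \<in> set p then if A i then (a - 1, b + 1) else (a + 1, b) else (a, b))"

definition add_type :: "bool \<Rightarrow> nat \<times> nat \<Rightarrow> nat \<times> nat" where
  "add_type t ab = (if t then (fst ab + 1, snd ab) else (fst ab, snd ab + 1))"

lemma type_count_Cons: "type_count A (j # p) = add_type (A j) (type_count A p)"
  by (simp add: type_count_def add_type_def)

lemma type_count_upd_Cons:
  assumes "j \<noteq> i"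
  shows "type_count_upd A i (j # p) = add_type (A j) (type_count_upd A i p)"
proof -
  \<comment> \<open>Truncated subtraction commutes with a later increment only when the count is
    positive.\<close>
  have "length (filter A p) > 0" if "i \<in> set p" "A i"
    using that by (auto simp: filter_empty_conv)
  then show ?thesis using assms
    by (cases "i \<in> set p"; cases "A i"; cases "A j")
      (simp_all add: type_count_upd_def type_count_def add_type_def)
qed

lemma type_count_upd_notin: "i \<notin> set p \<Longrightarrow> type_count_upd A i p = type_count A p"
  by (simp add: type_count_upd_def split: prod.split)

lemma type_count_upd_head:
  "type_count_upd A i (i # p) = (if A i then add_type False (type_count A p)
      else add_type True (add_type False (type_count A p)))"
  by (auto simp: type_count_upd_def type_count_def add_type_def)

text \<open>Both walks draw their first position from the same set, so it suffices to compare the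
  continuations after each common choice.\<close>

lemma path_walk_cong_coupling:
  fixes f g :: "nat list \<Rightarrow> 'b"
  assumes "out_idx es' v = out_idx es v"
    and "\<And>j. j \<in> out_idx es v \<Longrightarrow> v \<noteq> sp_sink \<Longrightarrow>
      map_pmf (\<lambda>p. f (j # p)) (path_walk es' k' (snd (es' ! j))) =
      map_pmf (\<lambda>p. g (j # p)) (path_walk es k (snd (es ! j)))"
    and "f [] = g []"
  shows "map_pmf f (path_walk es' (Suc k') v) = map_pmf g (path_walk es (Suc k) v)"
proof (cases "v = sp_sink \<or> out_idx es v = {}")
  case False
  then show ?thesis
    using assms by (simp add: map_bind_pmf pmf.map_comp o_def) (rule bind_pmf_cong, simp_all)
qed (use assms in auto)

lemma path_walk_stuck: "out_idx es v = {} \<Longrightarrow> path_walk es k v = return_pmf []"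
  by (cases k) auto


section \<open>Coupling the walks before and after one update\<close>

text \<open>Each network has its own rank function, because the update can lengthen paths and thus
  change the fuel required.\<close>

locale net_update =
  fixes es :: "(nat \<times> nat) list" and z i :: nat and rk rk' :: "nat \<Rightarrow> nat"
    and es' :: "(nat \<times> nat) list" and x y :: nat
  assumes i: "i < length es" and rk: "ranked rk es"
    and fresh: "\<And>j. j < length es \<Longrightarrow> fst (es ! j) < z \<and> snd (es ! j) < z" and z: "1 < z"
    and es': "es' = fst (sp_update (es, z) i)" and rk': "ranked rk' es'"
    and xy: "es ! i = (x, y)"
begin

abbreviation "tc \<equiv> type_count (single_out es)"
abbreviation "tc' \<equiv> type_count (single_out es')"
abbreviation "tcu \<equiv> type_count_upd (single_out es) i"

lemma i_notin: "p \<in> set_pmf (path_walk es k y) \<Longrightarrow> i \<notin> set p"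
  using path_walk_ranked[OF rk, of p k y] rankedD[OF rk i] xy by fastforce

lemma coupling_Cons:
  assumes "map_pmf tc' (path_walk es' k' w) = map_pmf tcu (path_walk es k w)"
    and "single_out es' j = single_out es j" "j \<noteq> i"
  shows "map_pmf (\<lambda>p. tc' (j # p)) (path_walk es' k' w) = map_pmf (\<lambda>p. tcu (j # p)) (path_walk es k w)"
proof -
  have "map_pmf (\<lambda>p. tc' (j # p)) (path_walk es' k' w) =
        map_pmf (add_type (single_out es j)) (map_pmf tc' (path_walk es' k' w))"
    unfolding pmf.map_comp by (simp add: type_count_Cons assms(2) o_def)
  then show ?thesis
    unfolding assms(1) by (simp add: type_count_upd_Cons[OF assms(3)] pmf.map_comp o_def)
qed

text \<open>Past the chosen edge the walk cannot meet it again, so the update correction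
  disappears.\<close>

lemma coupling_after:
  assumes "map_pmf tc' (path_walk es' k' y) = map_pmf tcu (path_walk es k y)"
  shows "map_pmf tc' (path_walk es' k' y) = map_pmf tc (path_walk es k y)"
  unfolding assms by (intro map_pmf_cong refl type_count_upd_notin i_notin)

text \<open>Only vertex \<open>x\<close> is affected. Whichever parallel copy is taken there, the
  walk continues from \<open>y\<close> and records a B-edge in place of the former A-edge. The claim
  ranges over all vertices and sufficient fuels so that the induction can restart at the head of
  each edge.\<close>

lemma coupling_double:
  assumes A: "single_out es i" and "rk v \<le> k" "rk' v \<le> k'"
  shows "map_pmf tc' (path_walk es' k' v) = map_pmf tcu (path_walk es k v)"
  using assms(2,3)
proof (induction k arbitrary: v k')
  have es'_eq: "es' = es @ [(x, y)]"
    using A xy by (simp add: es' sp_update_def single_out_def)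
  have "card (out_idx es x) = 1" using A xy by (simp add: single_out_def outdeg_eq_card)
  moreover have "i \<in> out_idx es x" using i xy by (simp add: out_idx_def)
  \<comment> \<open>Out-degree one makes \<open>i\<close> the only way out of \<open>x\<close>;
    after doubling there are exactly two, both of type B.\<close>
  ultimately have idx: "out_idx es x = {i}" by (metis card_1_singletonE singletonD)
  have idx_x: "out_idx es' x = {i, length es}"
    using idx by (simp add: es'_eq out_idx_snoc insert_commute)
  have idx_v: "out_idx es' v = out_idx es v" if "v \<noteq> x" for v
    using that by (simp add: es'_eq out_idx_snoc)
  {
    case (0 v k')
    have "out_idx es v = {}"
      using 0 rankedD[OF rk] by (fastforce simp: out_idx_def)
    moreover from this have "out_idx es' v = {}" using idx idx_v[of v] by auto
    ultimately show ?case by (simp add: path_walk_stuck type_count_upd_def type_count_def)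
  next
    case (Suc k v k')
    show ?case
    proof (cases "v = sp_sink \<or> out_idx es v = {}")
      case True
      moreover have "out_idx es v = {} \<Longrightarrow> out_idx es' v = {}" using idx idx_v[of v] by auto
      ultimately show ?thesis 
        by (cases k'; cases k) (auto simp: type_count_upd_def type_count_def)
    next
      case False
      have "out_idx es' v \<noteq> {}" using False idx_x idx_v[of v] by (cases "v = x") auto
      then obtain j where "j < length es'" "fst (es' ! j) = v" by (auto simp: out_idx_def)
      then have "rk' v > 0" using rankedD[OF rk', of j] by auto
      then obtain k'' where k': "k' = Suc k''" using Suc.prems by (cases k') auto
      show ?thesis
      proof (cases "v = x")
        case vx: False
        show ?thesis unfolding k'
        proof (rule path_walk_cong_coupling)
          fix j assume j: "j \<in> out_idx es v"
          then have j': "j < length es" "fst (es ! j) = v" by (auto simp: out_idx_def)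
          have tgt: "es' ! j = es ! j" using j' by (simp add: es'_eq nth_append)
          have "rk (snd (es ! j)) < rk v" "rk' (snd (es ! j)) < rk' v"
            using rankedD[OF rk, of j] rankedD[OF rk', of j] j' tgt by (auto simp: es'_eq)
          then have "map_pmf tc' (path_walk es' k'' (snd (es ! j))) = map_pmf tcu (path_walk es k (snd (es ! j)))"
            using Suc.prems k' by (intro Suc.IH) auto
          moreover have "single_out es' j = single_out es j"
            using vx j' tgt by (simp add: single_out_def outdeg_eq_card idx_v)
          moreover have "j \<noteq> i" using vx j' xy by auto
          ultimately show "map_pmf (\<lambda>p. tc' (j # p)) (path_walk es' k'' (snd (es' ! j))) =
              map_pmf (\<lambda>p. tcu (j # p)) (path_walk es k (snd (es ! j)))"
            unfolding tgt by (rule coupling_Cons)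
        qed (use idx_v[OF vx] in \<open>auto simp: type_count_upd_def type_count_def\<close>)
      next
        case vx: True
        have "rk y < rk x" "rk' y < rk' x"
          using rankedD[OF rk i] rankedD[OF rk', of i] xy i by (auto simp: es'_eq nth_append)
        then have IH: "map_pmf tc' (path_walk es' k'' y) = map_pmf tc (path_walk es k y)"
          using Suc.prems k' vx by (intro coupling_after Suc.IH) auto
        have B: "\<not> single_out es' j" "snd (es' ! j) = y" if "j \<in> {i, length es}" for j
          using that i xy idx_x
          by (auto simp: single_out_def es'_eq nth_append outdeg_eq_card)
        have "map_pmf tc' (path_walk es' k' v) =
          bind_pmf (pmf_of_set {i, length es}) (\<lambda>j. map_pmf (\<lambda>p. tc' (j # p)) (path_walk es' k'' (snd (es' ! j))))"
          using False vx idx_x by (simp add: k' map_bind_pmf pmf.map_comp o_def)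
        also have "\<dots> = bind_pmf (pmf_of_set {i, length es}) (\<lambda>j. map_pmf (add_type False) (map_pmf tc' (path_walk es' k'' y)))"
          using B by (intro bind_pmf_cong refl) (auto simp: type_count_Cons pmf.map_comp o_def)
        also have "\<dots> = map_pmf (\<lambda>p. tcu (i # p)) (path_walk es k y)"
          using A by (simp add: IH pmf.map_comp o_def type_count_upd_head)
        also have "\<dots> = map_pmf tcu (path_walk es (Suc k) v)"
          using False vx idx xy by (simp add: map_bind_pmf pmf.map_comp o_def pmf_of_set_singleton bind_return_pmf)
        finally show ?thesis .
      qed
    qed
  }
qed

text \<open>Old vertices keep their outgoing positions, hence old edges keep their types. A walk
  taking position \<open>i\<close> now passes \<open>z\<close>, whose single outgoing edge forces
  the next step and adds one A-edge. The vertex \<open>z\<close> itself is excluded because the old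
  walk stops there at once.\<close>

lemma coupling_subdivide:
  assumes A: "\<not> single_out es i" and "rk v \<le> k" "rk' v \<le> k'" "v \<noteq> z"
  shows "map_pmf tc' (path_walk es' k' v) = map_pmf tcu (path_walk es k v)"
  using assms(2-)
proof (induction k arbitrary: v k')
  have es'_eq: "es' = es[i := (x, z)] @ [(z, y)]"
    using A xy by (simp add: es' sp_update_def single_out_def)
  have fst_es': "fst (es' ! j) = fst (es ! j)" if "j < length es" for j
    using that xy by (cases "j = i") (simp_all add: es'_eq nth_append)
  have es'_n: "es' ! length es = (z, y)" by (simp add: es'_eq nth_append)
  have len: "length es' = Suc (length es)" by (simp add: es'_eq)
  have idx_v: "out_idx es' v = out_idx es v" if "v \<noteq> z" for v
    using that fst_es' es'_n by (auto simp: out_idx_def len less_Suc_eq)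
  have idx_z: "out_idx es' z = {length es}"
    using fst_es' es'_n fresh by (fastforce simp: out_idx_def len less_Suc_eq)
  {
    case (0 v k')
    have "out_idx es v = {}"
      using 0 rankedD[OF rk] by (fastforce simp: out_idx_def)
    with idx_v 0 show ?case by (simp add: path_walk_stuck type_count_upd_def type_count_def)
  next
    case (Suc k v k')
    show ?case
    proof (cases "v = sp_sink \<or> out_idx es v = {}")
      case True
      then show ?thesis using idx_v Suc.prems
        by (cases k'; cases k) (auto simp: type_count_upd_def type_count_def)
    next
      case False
      then have "out_idx es' v \<noteq> {}" using idx_v Suc.prems by auto
      then obtain j where "j < length es'" "fst (es' ! j) = v" by (auto simp: out_idx_def)
      then have "rk' v > 0" using rankedD[OF rk', of j] by auto
      then obtain k'' where k': "k' = Suc k''" using Suc.prems by (cases k') auto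
      show ?thesis unfolding k'
      proof (rule path_walk_cong_coupling)
        fix j assume j: "j \<in> out_idx es v"
        then have j': "j < length es" "fst (es ! j) = v" by (auto simp: out_idx_def)
        have so: "single_out es' j = single_out es j"
          using j' fst_es' Suc.prems by (simp add: single_out_def outdeg_eq_card idx_v)
        have rkj: "rk (snd (es ! j)) < rk v" "rk' (snd (es' ! j)) < rk' v"
          using rankedD[OF rk, of j] rankedD[OF rk', of j] j' fst_es' by (auto simp: len)
        show "map_pmf (\<lambda>p. tc' (j # p)) (path_walk es' k'' (snd (es' ! j))) =
              map_pmf (\<lambda>p. tcu (j # p)) (path_walk es k (snd (es ! j)))"
        proof (cases "j = i")
          case ji: False
          then have tgt: "es' ! j = es ! j" using j' by (simp add: es'_eq nth_append)
          have "snd (es ! j) \<noteq> z" using fresh j' by fastforce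
          then have "map_pmf tc' (path_walk es' k'' (snd (es ! j))) = map_pmf tcu (path_walk es k (snd (es ! j)))"
            using Suc.prems k' rkj tgt by (intro Suc.IH) auto
          then show ?thesis unfolding tgt using so ji by (rule coupling_Cons)
        next
          case ji: True
          have tgt: "snd (es' ! i) = z" using i by (simp add: es'_eq nth_append)
          have rkz: "rk' y < rk' z" using rankedD[OF rk', of "length es"] es'_n len by auto
          \<comment> \<open>Crossing the subdivided edge costs a second unit of fuel, available
            because \<open>rk'\<close> falls strictly from \<open>v\<close> to \<open>z\<close> and
            again from \<open>z\<close> to \<open>y\<close>.\<close>
          have "0 < k''" using rkz rkj(2) tgt ji Suc.prems k' by auto
          then obtain k3 where k'': "k'' = Suc k3" by (cases k'') auto
          have "y \<noteq> z" using fresh[OF i] xy by auto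
          then have IH: "map_pmf tc' (path_walk es' k3 y) = map_pmf tc (path_walk es k y)"
            using Suc.prems k' k'' rkj rkz ji xy tgt by (intro coupling_after Suc.IH) auto
          have zs: "z \<noteq> sp_sink" using z by (simp add: sp_sink_def)
          have n: "single_out es' (length es)"
            using idx_z es'_n by (simp add: single_out_def outdeg_eq_card)
          have "map_pmf (\<lambda>p. tc' (i # p)) (path_walk es' k'' z) =
             map_pmf (\<lambda>p. add_type False (add_type True p)) (map_pmf tc' (path_walk es' k3 y))"
            using idx_z zs es'_n n so A ji
            by (simp add: k'' map_bind_pmf pmf.map_comp o_def pmf_of_set_singleton bind_return_pmf type_count_Cons)
          also have "\<dots> = map_pmf (\<lambda>p. tcu (i # p)) (path_walk es k y)"
            using A by (simp add: IH pmf.map_comp o_def type_count_upd_head add_type_def)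
          finally show ?thesis using ji tgt xy by simp
        qed
      qed (use idx_v Suc.prems in \<open>auto simp: type_count_upd_def type_count_def\<close>)
    qed
  }
qed

lemma coupling:
  assumes "rk v \<le> k" "rk' v \<le> k'" "v \<noteq> z"
  shows "map_pmf tc' (path_walk es' k' v) = map_pmf tcu (path_walk es k v)"
  using coupling_double coupling_subdivide assms by blast

end

section \<open>Invariants of the generated networks\<close>

text \<open>Bounding the rank of the source by the number of edges makes the fuel in
  \<open>path_len\<close> sufficient. The label bounds keep the next vertex fresh and distinct from
  source and sink.\<close>

definition sp_inv :: "spnet \<Rightarrow> bool" where
  "sp_inv N \<longleftrightarrow> (\<exists>rk. ranked rk (fst N) \<and> rk sp_source \<le> length (fst N)) \<and>
     (\<forall>e\<in>set (fst N). fst e < snd N \<and> snd e < snd N) \<and> 1 < snd N \<and> fst N \<noteq> []"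

lemma sp_inv_init: "sp_inv sp_init"
proof -
  have "ranked (\<lambda>v. if v = 0 then 1 else 0) (fst sp_init)"
    by (simp add: ranked_def sp_init_def sp_source_def sp_sink_def)
  then show ?thesis unfolding sp_inv_def
    by (intro conjI exI[of _ "\<lambda>v. if v = 0 then 1 else 0"])
      (auto simp: sp_init_def sp_source_def sp_sink_def)
qed

lemma length_sp_update: "length (fst (sp_update N i)) = Suc (length (fst N))"
  by (simp add: sp_update_def Let_def split: prod.split)

text \<open>To make room for the subdivision vertex, all ranks above the head of the edge move up by one.\<close>
lemma sp_inv_update:
  assumes "sp_inv N" "i < length (fst N)"
  shows "sp_inv (sp_update N i)"
proof -
  obtain es z where N: "N = (es, z)" by (cases N)
  obtain x y where xy: "es ! i = (x, y)" by (cases "es ! i")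
  from assms(1) obtain rk where rk: "ranked rk es" "rk sp_source \<le> length es"
    and fr: "\<And>e. e \<in> set es \<Longrightarrow> fst e < z \<and> snd e < z" and z: "1 < z"
    by (auto simp: sp_inv_def N)
  have i: "i < length es" using assms(2) by (simp add: N)
  have xy_in: "(x, y) \<in> set es" using i xy by (metis nth_mem)
  have xyz: "x < z" "y < z" "rk y < rk x"
    using fr[OF xy_in] rk(1) xy_in by (auto simp: ranked_def)
  show ?thesis
  proof (cases "outdeg es x = 1")
    case True
    then have "sp_update N i = (es @ [(x, y)], z)" by (simp add: sp_update_def N xy)
    then show ?thesis using rk fr z xyz unfolding sp_inv_def
      by (auto intro!: exI[of _ rk] simp: ranked_def)
  next
    case False
    then have upd: "sp_update N i = (es[i := (x, z)] @ [(z, y)], Suc z)"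
      by (simp add: sp_update_def N xy)
    define rk' where "rk' v = (if v = z then Suc (rk y) else if rk v > rk y then Suc (rk v) else rk v)" for v
    have mono: "rk' w < rk' v" if "(v, w) \<in> set es" for v w
      using that fr[OF that] rk(1) by (auto simp: rk'_def ranked_def)
    have sub: "set (es[i := (x, z)] @ [(z, y)]) \<subseteq> insert (x, z) (insert (z, y) (set es))"
      using set_update_subset_insert[of es i "(x, z)"] by auto
    have "rk' z < rk' x" "rk' y < rk' z" using xyz by (auto simp: rk'_def)
    then have "ranked rk' (es[i := (x, z)] @ [(z, y)])"
      unfolding ranked_def using sub mono by blast
    moreover have "rk' sp_source \<le> Suc (length es)"
      using rk(2) z by (auto simp: rk'_def sp_source_def)
    moreover have "\<forall>e\<in>set (es[i := (x, z)] @ [(z, y)]). fst e < Suc z \<and> snd e < Suc z"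
      using sub fr xyz by (fastforce simp: less_Suc_eq)
    ultimately show ?thesis using z unfolding sp_inv_def upd
      by (intro conjI exI[of _ rk']) auto
  qed
qed

lemma sp_net_Suc: "n \<ge> 1 \<Longrightarrow> sp_net (Suc n) = bind_pmf (sp_net n) sp_step"
  by (cases n) (simp_all add: sp_net_def)

lemma sp_net_inv:
  "n \<ge> 1 \<Longrightarrow> N \<in> set_pmf (sp_net n) \<Longrightarrow> sp_inv N \<and> length (fst N) = n"
proof (induction n arbitrary: N rule: dec_induct)
  case base
  then show ?case using sp_inv_init by (auto simp: sp_net_def) (simp add: sp_init_def)
next
  case (step n)
  then obtain N0 where N0: "N0 \<in> set_pmf (sp_net n)" "N \<in> set_pmf (sp_step N0)"
    by (auto simp: sp_net_Suc)
  have inv: "sp_inv N0" "length (fst N0) = n" using step.IH N0 by auto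
  have "{..<n} \<noteq> {}" using step by (auto simp: lessThan_empty_iff)
  then obtain i where "i < n" "N = sp_update N0 i" using N0 inv by (auto simp: sp_step_def)
  then show ?case using inv by (simp add: sp_inv_update length_sp_update)
qed

lemma finite_set_sp_step: "sp_inv N \<Longrightarrow> finite (set_pmf (sp_step N))"
  by (auto simp: sp_step_def sp_inv_def lessThan_empty_iff)

lemma finite_set_sp_net: "n \<ge> 1 \<Longrightarrow> finite (set_pmf (sp_net n))"
proof (induction n rule: dec_induct)
  case (step n)
  then show ?case using finite_set_sp_step sp_net_inv by (auto simp: sp_net_Suc)
qed (simp add: sp_net_def)

lemma finite_set_path_walk: "finite (set_pmf (path_walk es k v))"
  by (induction k arbitrary: v) auto

text \<open>All laws that occur for finite networks have finite support, so conditioning raises no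
  integrability question.\<close>

lemma expectation_bind_finite:
  fixes h :: "'b \<Rightarrow> real"
  assumes "finite (set_pmf p)" "\<And>x. x \<in> set_pmf p \<Longrightarrow> finite (set_pmf (f x))"
  shows "measure_pmf.expectation (bind_pmf p f) h =
         measure_pmf.expectation p (\<lambda>x. measure_pmf.expectation (f x) h)"
  using pmf_expectation_bind[of "set_pmf p" f p h] assms
    integral_measure_pmf[of "set_pmf p" p "\<lambda>x. measure_pmf.expectation (f x) h"]
  by simp

section \<open>The Markov chain of edge types\<close>

definition path_types :: "spnet \<Rightarrow> (nat \<times> nat) pmf" where
  "path_types N = map_pmf (type_count (single_out (fst N)))
     (path_walk (fst N) (length (fst N)) sp_source)"

definition type_law :: "nat \<Rightarrow> (nat \<times> nat) pmf" where
  "type_law n = bind_pmf (sp_net n) path_types"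

lemma path_len_eq: "path_len n = map_pmf (\<lambda>(a, b). a + b) (type_law n)"
  by (simp add: path_len_def type_law_def path_types_def map_bind_pmf pmf.map_comp o_def
      sp_walk_eq_map_path_walk type_count_def sum_length_filter_compl)

text \<open>\<open>urn_gen f / n\<close> is the expected increment of \<open>f\<close> in the step
  from size \<open>n\<close>. At \<open>a = 0\<close> the truncated \<open>a - 1\<close> is harmless
  because of the factor \<open>a\<close>.\<close>

definition urn_gen :: "(nat \<times> nat \<Rightarrow> real) \<Rightarrow> nat \<times> nat \<Rightarrow> real" where
  "urn_gen f = (\<lambda>(a, b). real a * (f (a - 1, b + 1) - f (a, b)) + real b * (f (a + 1, b) - f (a, b)))"

text \<open>Positions off the path leave the counts alone; the \<open>a + b\<close> positions on it
  each contribute one jump.\<close>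

lemma sum_type_count_upd:
  assumes "distinct p" "set p \<subseteq> {..<n}"
  shows "(\<Sum>i<n. f (type_count_upd A i p)) = real n * f (type_count A p) + urn_gen f (type_count A p)"
proof -
  define a b where "a = length (filter A p)" and "b = length (filter (\<lambda>j. \<not> A j) p)"
  have ab: "type_count A p = (a, b)" by (simp add: type_count_def a_def b_def)
  have card: "card {i\<in>set p. A i} = a" "card {i\<in>set p. \<not> A i} = b"
    using assms(1) by (simp_all add: a_def b_def distinct_length_filter Int_def conj_commute)
  have "(\<Sum>i<n. f (type_count_upd A i p) - f (a, b)) = (\<Sum>i\<in>set p. f (type_count_upd A i p) - f (a, b))"
    using assms(2) by (intro sum.mono_neutral_right) (auto simp: type_count_upd_notin ab)
  also have "\<dots> = (\<Sum>i\<in>set p. if A i then f (a - 1, b + 1) - f (a, b) else f (a + 1, b) - f (a, b))"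
    by (intro sum.cong refl) (auto simp: type_count_upd_def ab)
  also have "\<dots> = urn_gen f (a, b)"
    by (subst sum.If_cases) (simp_all add: Int_def Collect_neg_eq[symmetric] card urn_gen_def)
  finally show ?thesis by (simp add: sum_subtractf ab algebra_simps)
qed

text \<open>The updated position is independent of the walk. By the coupling, the order of the draws
  can be exchanged: first a path in the old network, then the position, which averages to the
  generator.\<close>

lemma expectation_step:
  assumes inv: "sp_inv N"
  shows "measure_pmf.expectation (bind_pmf (sp_step N) path_types) f =
     measure_pmf.expectation (path_types N) (\<lambda>ab. f ab + urn_gen f ab / length (fst N))"
proof -
  define es z n where "es = fst N" and "z = snd N" and "n = length es"
  have N: "N = (es, z)" by (simp add: es_def z_def)
  obtain rk where rk: "ranked rk es" "rk sp_source \<le> n"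
    using inv by (auto simp: sp_inv_def N n_def)
  have ne: "{..<n} \<noteq> {}" "n > 0" using inv by (auto simp: sp_inv_def N n_def lessThan_empty_iff)
  define W where "W = path_walk es n sp_source"
  have step: "path_types (sp_update N i) = map_pmf (type_count_upd (single_out es) i) W" if i: "i < n" for i
  proof -
    define es' where "es' = fst (sp_update N i)"
    have inv': "sp_inv (sp_update N i)" using inv i by (intro sp_inv_update) (auto simp: N n_def)
    have len: "length es' = Suc n" by (simp add: es'_def length_sp_update N n_def)
    from inv' len obtain rk' where rk': "ranked rk' es'" "rk' sp_source \<le> Suc n"
      by (auto simp: sp_inv_def es'_def)
    interpret upd: net_update es z i rk rk' es' "fst (es ! i)" "snd (es ! i)"
      using inv i rk rk' by unfold_locales (auto simp: sp_inv_def N n_def es'_def)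
    have "sp_source \<noteq> z" using inv by (auto simp: sp_inv_def N sp_source_def)
    then show ?thesis
      using upd.coupling[OF rk(2) rk'(2)] len
      by (simp add: path_types_def W_def del: path_walk.simps flip: es'_def)
  qed
  have "bind_pmf (sp_step N) path_types =
      bind_pmf (pmf_of_set {..<n}) (\<lambda>i. map_pmf (type_count_upd (single_out es) i) W)"
    using step ne(1) unfolding sp_step_def bind_map_pmf N fst_conv n_def[symmetric]
    by (intro bind_pmf_cong refl) (simp add: set_pmf_of_set)
  also have "\<dots> = bind_pmf W (\<lambda>p. map_pmf (\<lambda>i. type_count_upd (single_out es) i p) (pmf_of_set {..<n}))"
    unfolding map_pmf_def by (rule bind_commute_pmf)
  finally have "measure_pmf.expectation (bind_pmf (sp_step N) path_types) f =
     measure_pmf.expectation W (\<lambda>p. (\<Sum>i<n. f (type_count_upd (single_out es) i p)) / n)"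
    using ne by (simp add: expectation_bind_finite W_def finite_set_path_walk integral_pmf_of_set)
  also have "\<dots> = measure_pmf.expectation W (\<lambda>p. f (type_count (single_out es) p) + urn_gen f (type_count (single_out es) p) / n)"
  proof (intro integral_cong_AE AE_pmfI)
    fix p assume "p \<in> set_pmf W"
    from path_walk_ranked[OF rk(1) this[unfolded W_def]]
    have "distinct p" "set p \<subseteq> {..<n}" by (auto simp: n_def)
    then show "(\<Sum>i<n. f (type_count_upd (single_out es) i p)) / n =
       f (type_count (single_out es) p) + urn_gen f (type_count (single_out es) p) / n"
      using ne by (simp add: sum_type_count_upd field_simps)
  qed auto
  also have "\<dots> = measure_pmf.expectation (path_types N) (\<lambda>ab. f ab + urn_gen f ab / n)"
    by (simp add: path_types_def W_def N n_def)
  finally show ?thesis by (simp add: n_def es_def)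
qed

lemma finite_set_path_types: "finite (set_pmf (path_types N))"
  by (simp add: path_types_def finite_set_path_walk)

lemma finite_set_type_law: "n \<ge> 1 \<Longrightarrow> finite (set_pmf (type_law n))"
  by (simp add: type_law_def finite_set_sp_net finite_set_path_types)

lemma type_law_1: "type_law 1 = return_pmf (1, 0)"
proof -
  have "out_idx [(0, 1)] 0 = {0}" by (auto simp: out_idx_def)
  then show ?thesis
    by (simp add: type_law_def sp_net_def path_types_def sp_init_def bind_return_pmf sp_source_def
      sp_sink_def pmf_of_set_singleton type_count_def single_out_def outdeg_eq_card)
qed

lemma type_law_Suc:
  assumes "n \<ge> 1"
  shows "measure_pmf.expectation (type_law (Suc n)) f =
    measure_pmf.expectation (type_law n) (\<lambda>ab. f ab + urn_gen f ab / n)"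
proof -
  have "measure_pmf.expectation (type_law (Suc n)) f = measure_pmf.expectation (sp_net n)
      (\<lambda>N. measure_pmf.expectation (bind_pmf (sp_step N) path_types) f)"
    unfolding type_law_def sp_net_Suc[OF assms] bind_assoc_pmf
    using assms sp_net_inv[OF assms] finite_set_sp_step
    by (intro expectation_bind_finite) (auto simp: finite_set_sp_net finite_set_path_types)
  also have "\<dots> = measure_pmf.expectation (sp_net n)
      (\<lambda>N. measure_pmf.expectation (path_types N) (\<lambda>ab. f ab + urn_gen f ab / n))"
    using sp_net_inv[OF assms] by (intro integral_cong_AE AE_pmfI) (auto simp: expectation_step)
  also have "\<dots> = measure_pmf.expectation (type_law n) (\<lambda>ab. f ab + urn_gen f ab / n)"
    unfolding type_law_def
    by (intro expectation_bind_finite[symmetric] finite_set_sp_net finite_set_path_types assms)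
  finally show ?thesis .
qed

lemma type_law_le:
  assumes "n \<ge> 1" "(a, b) \<in> set_pmf (type_law n)"
  shows "a + b \<le> n"
proof -
  from assms obtain N p where N: "N \<in> set_pmf (sp_net n)"
    and p: "p \<in> set_pmf (path_walk (fst N) n sp_source)" "(a, b) = type_count (single_out (fst N)) p"
    using sp_net_inv by (auto simp: type_law_def path_types_def)
  from sp_net_inv[OF assms(1) N] obtain rk where "ranked rk (fst N)" "length (fst N) = n"
    by (auto simp: sp_inv_def)
  with path_walk_ranked[of rk "fst N" p] p have "distinct p" "set p \<subseteq> {..<n}" by auto
  then have "length p \<le> n"
    by (metis card_lessThan card_mono distinct_card finite_lessThan)
  then show ?thesis using p sum_length_filter_compl[of "single_out (fst N)" p] by (simp add: type_count_def)
qed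

section \<open>Leading terms and polynomial bounds\<close>

text \<open>The base \<open>1 + a + b\<close> is at least 1, so bounds are monotone in the degree
  and remain meaningful at \<open>a = b = 0\<close>.\<close>

definition poly_bdd :: "nat \<Rightarrow> (nat \<Rightarrow> nat \<Rightarrow> real) \<Rightarrow> bool" where
  "poly_bdd d f \<longleftrightarrow> (\<exists>C. \<forall>a b. \<bar>f a b\<bar> \<le> C * (1 + real a + real b) ^ d)"

lemma poly_bddI: "(\<And>a b. \<bar>f a b\<bar> \<le> C * (1 + real a + real b) ^ d) \<Longrightarrow> poly_bdd d f"
  by (auto simp: poly_bdd_def)

lemma poly_bddE:
  assumes "poly_bdd d f"
  obtains C where "C \<ge> 0" "\<And>a b. \<bar>f a b\<bar> \<le> C * (1 + real a + real b) ^ d"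
proof -
  obtain C where C: "\<And>a b. \<bar>f a b\<bar> \<le> C * (1 + real a + real b) ^ d"
    using assms by (auto simp: poly_bdd_def)
  have "C \<ge> 0" using order_trans[OF abs_ge_zero C[of 0 0]] by simp
  with C show ?thesis by (intro that)
qed

lemma poly_bdd_mono:
  assumes "poly_bdd d f" "d \<le> e"
  shows "poly_bdd e f"
proof -
  obtain C where C: "C \<ge> 0" "\<And>a b. \<bar>f a b\<bar> \<le> C * (1 + real a + real b) ^ d"
    using assms(1) by (rule poly_bddE) blast
  have "\<bar>f a b\<bar> \<le> C * (1 + real a + real b) ^ e" for a b
    by (rule order_trans[OF C(2)]) (use C assms(2) in \<open>auto intro!: mult_left_mono power_increasing\<close>)
  then show ?thesis by (rule poly_bddI)
qed

lemma poly_bdd_const: "poly_bdd 0 (\<lambda>_ _. c)"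
  by (rule poly_bddI[of _ "\<bar>c\<bar>"]) simp

lemma poly_bdd_linear: "poly_bdd 1 (\<lambda>a b. real a * u + real b * v)"
proof (rule poly_bddI[of _ "\<bar>u\<bar> + \<bar>v\<bar>"])
  fix a b
  have "\<bar>real a * u + real b * v\<bar> \<le> real a * \<bar>u\<bar> + real b * \<bar>v\<bar>"
    by (rule order_trans[OF abs_triangle_ineq]) (simp add: abs_mult)
  also have "\<dots> \<le> (1 + real a + real b) * \<bar>u\<bar> + (1 + real a + real b) * \<bar>v\<bar>"
    by (intro add_mono mult_right_mono) auto
  finally show "\<bar>real a * u + real b * v\<bar> \<le> (\<bar>u\<bar> + \<bar>v\<bar>) * (1 + real a + real b) ^ 1"
    by (simp add: algebra_simps)
qed

lemma poly_bdd_add: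
  assumes "poly_bdd d f" "poly_bdd d g"
  shows "poly_bdd d (\<lambda>a b. f a b + g a b)"
proof -
  obtain C where C: "\<And>a b. \<bar>f a b\<bar> \<le> C * (1 + real a + real b) ^ d"
    using assms(1) by (rule poly_bddE) blast
  obtain D where D: "\<And>a b. \<bar>g a b\<bar> \<le> D * (1 + real a + real b) ^ d"
    using assms(2) by (rule poly_bddE) blast
  show ?thesis
  proof (rule poly_bddI[of _ "C + D"])
    fix a b show "\<bar>f a b + g a b\<bar> \<le> (C + D) * (1 + real a + real b) ^ d"
      using abs_triangle_ineq[of "f a b" "g a b"] C[of a b] D[of a b] unfolding distrib_right by linarith
  qed
qed

lemma poly_bdd_mult:
  assumes "poly_bdd d f" "poly_bdd e g"
  shows "poly_bdd (d + e) (\<lambda>a b. f a b * g a b)"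
proof -
  obtain C where C: "C \<ge> 0" "\<And>a b. \<bar>f a b\<bar> \<le> C * (1 + real a + real b) ^ d"
    using assms(1) by (rule poly_bddE) blast
  obtain D where D: "D \<ge> 0" "\<And>a b. \<bar>g a b\<bar> \<le> D * (1 + real a + real b) ^ e"
    using assms(2) by (rule poly_bddE) blast
  show ?thesis
  proof (rule poly_bddI[of _ "C * D"])
    fix a b
    have "\<bar>f a b * g a b\<bar> \<le> (C * (1 + real a + real b) ^ d) * (D * (1 + real a + real b) ^ e)"
      unfolding abs_mult using C D by (intro mult_mono) auto
    then show "\<bar>f a b * g a b\<bar> \<le> C * D * (1 + real a + real b) ^ (d + e)"
      by (simp add: power_add algebra_simps)
  qed
qed

lemma poly_bdd_cmult: "poly_bdd d f \<Longrightarrow> poly_bdd d (\<lambda>a b. c * f a b)"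
  using poly_bdd_mult[OF poly_bdd_const] by simp

lemma poly_bdd_sum:
  "finite I \<Longrightarrow> (\<And>i. i \<in> I \<Longrightarrow> poly_bdd d (f i)) \<Longrightarrow> poly_bdd d (\<lambda>a b. \<Sum>i\<in>I. f i a b)"
proof (induction I rule: finite_induct)
  case empty
  then show ?case using poly_bdd_mono[OF poly_bdd_const[of 0], of d] by simp
next
  case (insert i I)
  then show ?case by (simp add: poly_bdd_add)
qed

lemma poly_bdd_power: "poly_bdd 1 f \<Longrightarrow> poly_bdd r (\<lambda>a b. f a b ^ r)"
proof (induction r)
  case 0
  then show ?case using poly_bdd_const[of 1] by simp
next
  case (Suc r)
  then show ?case using poly_bdd_mult[of 1 f r "\<lambda>a b. f a b ^ r"] by simp
qed

text \<open>The logarithmic derivative of \<open>A ^ a * B ^ b\<close> is linear in \<open>a\<close> and \<open>b\<close>.\<close>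
lemma fps_nth_power_mult_power_leading:
  fixes A B :: "real fps"
  assumes A0: "fps_nth A 0 = 1" and B0: "fps_nth B 0 = 1"
  shows "poly_bdd (r - 1) (\<lambda>a b. fact r * fps_nth (A ^ a * B ^ b) r
           - (real a * fps_nth A 1 + real b * fps_nth B 1) ^ r)"
proof -
  define u v where "u = fps_deriv A * inverse A" and "v = fps_deriv B * inverse B"
  define w where "w k a b = real a * fps_nth u k + real b * fps_nth v k" for k a b
  define g where "g r a b = fps_nth (A ^ a * B ^ b) r" for r a b
  have u: "fps_deriv A = u * A" and v: "fps_deriv B = v * B"
    using A0 B0 by (simp_all add: u_def v_def mult.assoc inverse_mult_eq_1)
  have pw: "fps_deriv (A ^ a) = of_nat a * u * A ^ a" for a
    by (induction a) (simp_all add: u algebra_simps del: fps_deriv_power)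
  have pw': "fps_deriv (B ^ b) = of_nat b * v * B ^ b" for b
    by (induction b) (simp_all add: v algebra_simps del: fps_deriv_power)
  have deriv: "fps_deriv (A ^ a * B ^ b) = (of_nat a * u + of_nat b * v) * (A ^ a * B ^ b)" for a b
    by (simp add: pw pw' algebra_simps)
  have rec: "real (Suc r) * g (Suc r) a b = (\<Sum>k=0..r. w k a b * g (r - k) a b)" for r a b
  proof -
    have "real (Suc r) * g (Suc r) a b = fps_nth (fps_deriv (A ^ a * B ^ b)) r"
      by (simp only: g_def fps_deriv_nth Suc_eq_plus1)
    also have "\<dots> = (\<Sum>k=0..r. w k a b * g (r - k) a b)"
      unfolding deriv fps_mult_nth[of "of_nat a * u + of_nat b * v"] w_def g_def
      by (simp add: fps_mult_of_nat_nth)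
    finally show ?thesis .
  qed
  have w0: "w 0 a b = real a * fps_nth A 1 + real b * fps_nth B 1" for a b
    using A0 B0 by (simp add: w_def u_def v_def)
  have wb: "poly_bdd 1 (w k)" for k unfolding w_def by (rule poly_bdd_linear)
  define D where "D r a b = fact r * g r a b - w 0 a b ^ r" for r a b
  have "poly_bdd (r - 1) (D r)" for r
  proof (induction r rule: less_induct)
    case (less r)
    show ?case
    proof (cases r)
      case 0
      then have "D r = (\<lambda>_ _. 0)" using A0 B0 by (simp add: fun_eq_iff D_def g_def fps_nth_power_0)
      then show ?thesis using 0 poly_bdd_const[of 0] by simp
    next
      case (Suc q)
      have gb: "poly_bdd k (g k)" if "k \<le> q" for k
      proof -
        have "poly_bdd k (\<lambda>a b. 1 / fact k * (D k a b + w 0 a b ^ k))"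
          using that Suc by (intro poly_bdd_cmult poly_bdd_add poly_bdd_power wb
              poly_bdd_mono[OF less.IH]) auto
        then show ?thesis by (simp add: D_def)
      qed
      \<comment> \<open>The term \<open>k = 0\<close> of the recursion supplies the leading factor
        \<open>w 0\<close>. For \<open>k \<ge> 1\<close> the product has degree at most
        \<open>1 + (q - k) \<le> q\<close> and joins the error.\<close>
      have "D r a b = w 0 a b * D q a b + fact q * (\<Sum>k=1..q. w k a b * g (q - k) a b)" for a b
      proof -
        have "fact r * g r a b = fact q * (real (Suc q) * g (Suc q) a b)" by (simp add: Suc)
        also note rec
        also have "(\<Sum>k=0..q. w k a b * g (q - k) a b) = w 0 a b * g q a b + (\<Sum>k=1..q. w k a b * g (q - k) a b)"
          by (simp add: sum.atLeast_Suc_atMost)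
        finally show ?thesis by (simp add: D_def Suc algebra_simps)
      qed
      then have D: "D r = (\<lambda>a b. w 0 a b * D q a b + fact q * (\<Sum>k=1..q. w k a b * g (q - k) a b))"
        by (simp add: fun_eq_iff)
      have 1: "poly_bdd q (\<lambda>a b. w 0 a b * D q a b)"
      proof (cases q)
        \<comment> \<open>Here \<open>q - 1\<close> truncates to 0, so the induction hypothesis
          would give degree 1 instead of 0; that the error vanishes is used directly.\<close>
        case 0
        then have "D q = (\<lambda>_ _. 0)" using A0 B0 by (simp add: fun_eq_iff D_def g_def fps_nth_power_0)
        then show ?thesis using 0 poly_bdd_const[of 0] by simp
      next
        case (Suc p)
        then show ?thesis using poly_bdd_mult[OF wb less.IH[of q]] \<open>r = Suc q\<close> by simp
      qed
      have 2: "poly_bdd q (\<lambda>a b. \<Sum>k=1..q. w k a b * g (q - k) a b)"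
      proof (rule poly_bdd_sum)
        fix k assume "k \<in> {1..q}"
        then show "poly_bdd q (\<lambda>a b. w k a b * g (q - k) a b)"
          by (intro poly_bdd_mono[OF poly_bdd_mult[OF wb gb]]) auto
      qed simp
      show ?thesis unfolding D using 1 2 by (simp add: Suc poly_bdd_add poly_bdd_cmult)
    qed
  qed
  then have "poly_bdd (r - 1) (\<lambda>a b. D r a b)" by simp
  then show ?thesis unfolding D_def g_def w0 .
qed

text \<open>The product equals \<open>pochhammer (x + 1) (n - 1) / fact (n - 1)\<close>. The
  Euler-type sequence \<open>rGamma_series (x + 1) n\<close> has two more Pochhammer factors, which
  are removed by quotients tending to 1.\<close>

lemma LIMSEQ_prod_one_plus_div:
  fixes x :: real
  assumes "x \<ge> 0"
  shows "(\<lambda>n. (\<Prod>k=1..<n. 1 + x / real k) / real n powr x) \<longlonglongrightarrow> 1 / Gamma (x + 1)"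
proof -
  have prod: "(\<Prod>k=1..<Suc m. 1 + x / real k) = pochhammer (x + 1) m / fact m" for m
  proof (induction m)
    case (Suc m)
    have "(\<Prod>k=1..<Suc (Suc m). 1 + x / real k) = (\<Prod>k=1..<Suc m. 1 + x / real k) * (1 + x / real (Suc m))"
      by (rule prod.atLeastLessThan_Suc) simp
    also have "\<dots> = pochhammer (x + 1) (Suc m) / fact (Suc m)"
      unfolding Suc.IH by (simp add: pochhammer_Suc field_simps)
    finally show ?case .
  qed simp
  have l: "(\<lambda>n. real n / (y + real n)) \<longlonglongrightarrow> 1" if "y \<ge> 0" for y :: real
  proof -
    have "(\<lambda>n. inverse (1 + y * inverse (real n))) \<longlonglongrightarrow> inverse (1 + y * 0)"
      by (intro tendsto_intros lim_inverse_n) auto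
    then have l: "(\<lambda>n. inverse (1 + y * inverse (real n))) \<longlonglongrightarrow> 1" by simp
    show ?thesis
      by (rule Lim_transform_eventually[OF l], rule eventually_mono[OF eventually_gt_at_top[of 0]])
        (use that in \<open>simp add: field_simps\<close>)
  qed
  have "(\<lambda>n. rGamma_series (x + 1) n * (real n / (x + real n)) * (real n / (x + 1 + real n)))
      \<longlonglongrightarrow> rGamma (x + 1) * 1 * 1"
    using assms by (intro tendsto_mult rGamma_series_LIMSEQ l) auto
  then have *: "(\<lambda>n. rGamma_series (x + 1) n * (real n / (x + real n)) * (real n / (x + 1 + real n)))
      \<longlonglongrightarrow> 1 / Gamma (x + 1)"
    by (simp add: Gamma_def field_simps)
  show ?thesis
  proof (rule Lim_transform_eventually[OF *], rule eventually_mono[OF eventually_gt_at_top[of 0]])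
    fix n :: nat assume n: "n > 0"
    then obtain m where m: "n = Suc m" by (cases n) auto
    define P N where "P = pochhammer (x + 1) m" and "N = real n"
    have N: "N > 0" "x + N > 0" "x + 1 + N > 0" using n assms by (simp_all add: N_def)
    have poch: "pochhammer (x + 1) (n + 1) = P * (x + N) * (x + 1 + N)"
      by (simp add: m P_def N_def pochhammer_Suc algebra_simps)
    have fct: "fact n = N * fact m" by (simp add: m N_def)
    have "exp ((x + 1) * ln N) = N powr x * N"
      using N by (simp add: powr_def ring_distribs exp_add)
    then have "rGamma_series (x + 1) n = P * (x + N) * (x + 1 + N) / (N * fact m * (N powr x * N))"
      unfolding rGamma_series_def poch fct by (simp add: N_def)
    then have "rGamma_series (x + 1) n * (N / (x + N)) * (N / (x + 1 + N)) = P / (fact m * N powr x)"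
      using N by (simp add: divide_simps) (simp add: mult_ac)
    also have "\<dots> = (\<Prod>k=1..<n. 1 + x / real k) / N powr x"
      unfolding m prod P_def by simp
    finally show "rGamma_series (x + 1) n * (real n / (x + real n)) * (real n / (x + 1 + real n)) =
       (\<Prod>k=1..<n. 1 + x / real k) / real n powr x" by (simp add: N_def)
  qed
qed

section \<open>Eigenfunctions of the chain\<close>

lemma phi_t_sq: "phi_t ^ 2 = 1 - phi_t"
  by (simp add: phi_t_def power2_eq_square field_simps)

lemma phi_t_bounds: "1 / 2 < phi_t" "phi_t < 1"
proof -
  have "sqrt 5 > 2" "sqrt 5 < 3" by (auto intro: real_less_rsqrt real_less_lsqrt)
  then show "1 / 2 < phi_t" "phi_t < 1" by (auto simp: phi_t_def)
qed

locale urn_coeffs =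
  fixes c :: "nat \<Rightarrow> real"
  assumes c0: "c 0 = 1"
    and c1: "c 1 = (3 + phi_t) / 5"
    and crec: "\<And>r. r \<ge> 2 \<Longrightarrow>
       c r = (1 / (phi_t * real (r - 1) * ((real r + 1) * phi_t + 1))) *
             (\<Sum>k = 1..r - 1. (real k * phi_t + 1) * c k * c (r - k))"
begin

definition A :: "real fps" where "A = Abs_fps c"
definition B :: "real fps" where "B = Abs_fps (\<lambda>k. (real k * phi_t + 1) * c k)"

lemma A_ode: "fps_const phi_t * (fps_X * fps_deriv A) = B - A"
proof (rule fps_ext)
  fix n show "fps_nth (fps_const phi_t * (fps_X * fps_deriv A)) n = fps_nth (B - A) n"
    by (cases n) (simp_all add: A_def B_def algebra_simps)
qed

text \<open>This is the recursion for \<open>c\<close> in disguise: in the convolution for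
  \<open>B * (A - 1)\<close> the term with index 0 is \<open>c n\<close>, and the remaining terms
  form the sum in \<open>crec\<close>.\<close>

lemma B_ode: "fps_const phi_t * (fps_X * fps_deriv B) = B * (A - 1)"
proof (rule fps_ext)
  fix n show "fps_nth (fps_const phi_t * (fps_X * fps_deriv B)) n = fps_nth (B * (A - 1)) n"
  proof (cases n)
    case 0
    then show ?thesis by (simp add: A_def B_def c0)
  next
    case (Suc m)
    have "fps_nth (B * (A - 1)) n = (\<Sum>i=0..n. fps_nth B i * fps_nth (A - 1) (n - i))"
      by (rule fps_mult_nth)
    also have "\<dots> = (\<Sum>i=0..m. fps_nth B i * fps_nth (A - 1) (n - i))"
      by (simp add: Suc A_def c0)
    also have "\<dots> = (\<Sum>i=0..m. (real i * phi_t + 1) * c i * c (n - i))"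
      by (intro sum.cong refl) (auto simp: Suc A_def B_def)
    also have "\<dots> = c n + (\<Sum>i=1..m. (real i * phi_t + 1) * c i * c (n - i))"
      by (simp add: sum.atLeast_Suc_atMost c0)
    also have "\<dots> = phi_t * real n * ((real n * phi_t + 1) * c n)"
    proof (cases "n \<ge> 2")
      case True
      define S where "S = (\<Sum>i=1..m. (real i * phi_t + 1) * c i * c (n - i))"
      define q where "q = phi_t * (real n - 1) * ((real n + 1) * phi_t + 1)"
      have "q > 0" using True phi_t_bounds unfolding q_def
        by (intro mult_pos_pos add_nonneg_pos) auto
      moreover have "c n = 1 / q * S"
        using crec[OF True] Suc True by (simp add: q_def S_def of_nat_diff)
      ultimately have S: "S = q * c n" by (simp add: field_simps)
      \<comment> \<open>The constant term left after expanding is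
        \<open>1 - phi_t - phi_t ^ 2\<close>, which is zero.\<close>
      have "1 + q = phi_t * real n * (real n * phi_t + 1)"
        using phi_t_sq unfolding q_def power2_eq_square by algebra
      then have "phi_t * real n * ((real n * phi_t + 1) * c n) = (1 + q) * c n" by simp
      then show ?thesis unfolding S_def[symmetric] S by (simp add: algebra_simps)
    next
      \<comment> \<open>At \<open>n = 1\<close> the sum is empty and the equation reduces to
        \<open>phi_t * (phi_t + 1) = 1\<close>. The value of \<open>c 1\<close> is a choice of scale
        that matters when \<open>X\<close> is compared with the length.\<close>
      case False
      then have "n = 1" using Suc by simp
      moreover have "phi_t * (phi_t + 1) = 1" using phi_t_sq by (simp add: power2_eq_square algebra_simps)
      then have "phi_t * ((phi_t + 1) * c 1) = c 1" by (simp flip: mult.assoc)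
      ultimately show ?thesis using Suc by simp
    qed
    finally show ?thesis by (simp add: Suc B_def)
  qed
qed

definition g :: "nat \<Rightarrow> nat \<times> nat \<Rightarrow> real" where
  "g r = (\<lambda>(a, b). fps_nth (A ^ a * B ^ b) r)"

text \<open>The operator \<open>\<phi> s d/ds\<close> is a derivation. By the two differential
  equations it trades one factor \<open>A\<close> for \<open>B\<close>, or appends a factor
  \<open>A\<close> beside a \<open>B\<close>, exactly as the chain jumps; on the coefficient of
  order \<open>r\<close> it acts as multiplication by \<open>r \<phi>\<close>.\<close>

lemma urn_gen_g: "urn_gen (g r) ab = real r * phi_t * g r ab"
proof -
  obtain a b where ab: "ab = (a, b)" by (cases ab)
  define F where "F = A ^ a * B ^ b"
  have dA: "fps_const phi_t * (fps_X * fps_deriv (A ^ a)) = of_nat a * (A ^ (a - 1) * B - A ^ a)"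
  proof (cases a)
    case (Suc k)
    have "fps_const phi_t * (fps_X * fps_deriv (A ^ a)) =
        of_nat a * (fps_const phi_t * (fps_X * fps_deriv A)) * A ^ k"
      unfolding Suc fps_deriv_power' diff_Suc_1 by (simp only: mult_ac)
    then show ?thesis unfolding A_ode by (simp add: Suc algebra_simps)
  qed simp
  have dB: "fps_const phi_t * (fps_X * fps_deriv (B ^ b)) = of_nat b * (A * B ^ b - B ^ b)"
  proof (cases b)
    case (Suc k)
    have "fps_const phi_t * (fps_X * fps_deriv (B ^ b)) =
        of_nat b * (fps_const phi_t * (fps_X * fps_deriv B)) * B ^ k"
      unfolding Suc fps_deriv_power' diff_Suc_1 by (simp only: mult_ac)
    then show ?thesis unfolding B_ode by (simp add: Suc algebra_simps)
  qed simp
  have "fps_const phi_t * (fps_X * fps_deriv F) =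
      fps_const phi_t * (fps_X * fps_deriv (A ^ a)) * B ^ b +
      A ^ a * (fps_const phi_t * (fps_X * fps_deriv (B ^ b)))"
    unfolding F_def fps_deriv_mult by (simp only: algebra_simps)
  also have "\<dots> = of_nat a * (A ^ (a - 1) * B ^ (b + 1) - F) + of_nat b * (A ^ (a + 1) * B ^ b - F)"
    unfolding dA dB F_def by (simp add: algebra_simps)
  finally have "fps_nth (fps_const phi_t * (fps_X * fps_deriv F)) r =
     fps_nth (of_nat a * (A ^ (a - 1) * B ^ (b + 1) - F) + of_nat b * (A ^ (a + 1) * B ^ b - F)) r"
    by simp
  also have "\<dots> = urn_gen (g r) ab"
    unfolding fps_add_nth fps_sub_nth fps_mult_of_nat_nth by (simp add: urn_gen_def g_def ab F_def)
  also have "fps_nth (fps_const phi_t * (fps_X * fps_deriv F)) r = real r * phi_t * fps_nth F r"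
    by (cases r) (simp_all add: F_def del: fps_deriv_mult)
  finally show ?thesis by (simp add: g_def ab F_def)
qed

text \<open>Each step from size \<open>n\<close> multiplies the expectation by
  \<open>1 + r \<phi> / n\<close>, starting from the value \<open>c r\<close> at the state
  \<open>(1, 0)\<close>.\<close>

lemma expectation_g:
  "n \<ge> 1 \<Longrightarrow> measure_pmf.expectation (type_law n) (g r) = c r * (\<Prod>k=1..<n. 1 + real r * phi_t / real k)"
proof (induction n rule: dec_induct)
  case base
  then show ?case by (simp only: type_law_1) (simp add: g_def A_def)
next
  case (step n)
  have "measure_pmf.expectation (type_law (Suc n)) (g r) =
      measure_pmf.expectation (type_law n) (\<lambda>ab. (1 + real r * phi_t / n) * g r ab)"
    unfolding type_law_Suc[OF step(1)] urn_gen_g by (simp add: algebra_simps)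
  also have "\<dots> = (1 + real r * phi_t / n) * (c r * (\<Prod>k=1..<n. 1 + real r * phi_t / real k))"
    using step.IH by simp
  finally show ?case using step(1) by (simp add: mult_ac)
qed

section \<open>Growth of the limiting moments\<close>

text \<open>Each of the \<open>r - 1\<close> summands has its linear factor bounded by
  \<open>Q\<close>, so the denominator of \<open>crec\<close> cancels both and leaves one factor
  \<open>phi_t\<close>. The base \<open>c 1 / phi_t\<close> gives equality at
  \<open>r = 1\<close>.\<close>

lemma coeff_bound:
  assumes "r \<ge> 1"
  shows "0 \<le> c r \<and> c r \<le> phi_t * (c 1 / phi_t) ^ r"
  using assms
proof (induction r rule: less_induct)
  case (less r)
  define K where "K = c 1 / phi_t"
  have K: "K > 0" using phi_t_bounds c1 by (simp add: K_def)
  show ?case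
  proof (cases "r = 1")
    case True
    then show ?thesis using phi_t_bounds c1 by simp
  next
    case False
    then have r: "r \<ge> 2" using less.prems by simp
    define S where "S = (\<Sum>k = 1..r - 1. (real k * phi_t + 1) * c k * c (r - k))"
    define Q where "Q = (real r + 1) * phi_t + 1"
    have Q: "Q > 0" using phi_t_bounds by (simp add: Q_def add_nonneg_pos)
    have bnd: "0 \<le> (real k * phi_t + 1) * c k * c (r - k) \<and>
        (real k * phi_t + 1) * c k * c (r - k) \<le> Q * (phi_t\<^sup>2 * K ^ r)" if k: "k \<in> {1..r - 1}" for k
    proof -
      have IH: "0 \<le> c k" "c k \<le> phi_t * K ^ k" "0 \<le> c (r - k)" "c (r - k) \<le> phi_t * K ^ (r - k)"
        using less.IH[of k] less.IH[of "r - k"] k r by (auto simp: K_def)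
      have p: "0 \<le> real k * phi_t + 1" "real k * phi_t + 1 \<le> Q"
        using phi_t_bounds k by (auto simp: Q_def intro!: mult_right_mono)
      have "c k * c (r - k) \<le> (phi_t * K ^ k) * (phi_t * K ^ (r - k))"
        using IH phi_t_bounds K by (intro mult_mono) auto
      also have "\<dots> = phi_t\<^sup>2 * (K ^ k * K ^ (r - k))" by (simp add: power2_eq_square)
      also have "K ^ k * K ^ (r - k) = K ^ r" using k by (subst power_add[symmetric]) auto
      finally have cc: "c k * c (r - k) \<le> phi_t\<^sup>2 * K ^ r" .
      have "(real k * phi_t + 1) * (c k * c (r - k)) \<le> Q * (phi_t\<^sup>2 * K ^ r)"
        by (rule mult_mono[OF p(2) cc]) (use Q IH in auto)
      then show ?thesis using p IH by (simp add: mult.assoc)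
    qed
    have S0: "0 \<le> S" unfolding S_def using bnd by (intro sum_nonneg) blast
    have "S \<le> (\<Sum>k = 1..r - 1. Q * (phi_t\<^sup>2 * K ^ r))" unfolding S_def using bnd by (intro sum_mono) blast
    then have S1: "S \<le> real (r - 1) * Q * (phi_t\<^sup>2 * K ^ r)" by simp
    have c: "c r = 1 / (phi_t * real (r - 1) * Q) * S" using crec[OF r] by (simp add: S_def Q_def)
    have d: "phi_t * real (r - 1) * Q > 0" using r Q phi_t_bounds by simp
    have "c r \<le> 1 / (phi_t * real (r - 1) * Q) * (real (r - 1) * Q * (phi_t\<^sup>2 * K ^ r))"
      unfolding c by (rule mult_left_mono[OF S1 divide_nonneg_pos[OF zero_le_one d]])
    also have "\<dots> = phi_t * K ^ r" using r Q phi_t_bounds by (simp add: power2_eq_square)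
    finally have "c r \<le> phi_t * K ^ r" .
    moreover have "0 \<le> c r"
      unfolding c by (rule mult_nonneg_nonneg[OF divide_nonneg_pos[OF zero_le_one d] S0])
    ultimately show ?thesis by (simp add: K_def)
  qed
qed

definition mom :: "nat \<Rightarrow> real" where
  "mom r = fact r * c r / Gamma (real r * phi_t + 1)"

text \<open>The factorials cancel, the coefficients grow geometrically, and the Gamma function in
  the denominator outgrows them.\<close>

lemma mom_small: "(\<lambda>N. \<bar>t\<bar> ^ (2 * N) / fact (2 * N) * mom (2 * N)) \<longlonglongrightarrow> 0"
proof -
  define K where "K = c 1 / phi_t"
  define x where "x = (K * \<bar>t\<bar>)\<^sup>2"
  have K: "K > 0" using phi_t_bounds c1 by (simp add: K_def)
  have lim: "(\<lambda>N. x ^ N / fact N) \<longlonglongrightarrow> 0"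
    using summable_LIMSEQ_zero[OF summable_exp[of x]] by (simp add: field_simps)
  have "norm (\<bar>t\<bar> ^ (2 * N) / fact (2 * N) * mom (2 * N)) \<le> x ^ N / fact N" if N: "N \<ge> 1" for N
  proof -
    \<comment> \<open>Since \<open>2 * phi_t > 1\<close>, the argument exceeds
      \<open>N + 1\<close>.\<close>
    have G: "fact N \<le> Gamma (real (2 * N) * phi_t + 1)"
    proof -
      have "real N * 1 < real N * (2 * phi_t)" using N phi_t_bounds by (intro mult_strict_left_mono) auto
      then have "Gamma (1 + real N) < Gamma (real (2 * N) * phi_t + 1)"
        using N by (intro Gamma_real_strict_mono) (auto simp: mult_ac)
      then show ?thesis by (simp add: Gamma_fact)
    qed
    have cb: "0 \<le> c (2 * N)" "c (2 * N) \<le> phi_t * K ^ (2 * N)"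
      using coeff_bound[of "2 * N"] N by (auto simp: K_def)
    have "c (2 * N) \<le> 1 * K ^ (2 * N)"
      using cb(2) phi_t_bounds K by (elim order_trans) (intro mult_right_mono, auto)
    then have "\<bar>t\<bar> ^ (2 * N) * c (2 * N) \<le> \<bar>t\<bar> ^ (2 * N) * K ^ (2 * N)"
      by (intro mult_left_mono) auto
    also have "\<dots> = x ^ N" by (simp add: x_def power_mult power_mult_distrib)
    finally have "\<bar>t\<bar> ^ (2 * N) * c (2 * N) / Gamma (real (2 * N) * phi_t + 1) \<le> x ^ N / fact N"
      using G by (intro frac_le) (auto simp: x_def)
    moreover have "0 \<le> \<bar>t\<bar> ^ (2 * N) * c (2 * N) / Gamma (real (2 * N) * phi_t + 1)"
      using cb less_le_trans[OF fact_gt_zero G] by (intro divide_nonneg_pos mult_nonneg_nonneg) auto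
    ultimately show ?thesis by (simp add: mom_def)
  qed
  then show ?thesis by (intro Lim_null_comparison[OF _ lim] eventually_sequentiallyI[of 1])
qed

end

section \<open>The limit law\<close>

lemma type_law_0: "type_law 0 = type_law 1"
  by (simp add: type_law_def sp_net_def)

lemma integrable_type_law: "integrable (measure_pmf (type_law n)) (f :: nat \<times> nat \<Rightarrow> real)"
  by (cases n) (simp_all add: type_law_0 integrable_measure_pmf_finite finite_set_type_law)

lemma powr_of_nat_LIMSEQ_0:
  fixes s :: real
  assumes "s < 0"
  shows "(\<lambda>n. real n powr s) \<longlonglongrightarrow> 0"
  using assms by (rule tendsto_neg_powr[OF _ filterlim_real_sequentially])

lemma one_plus_power_le:
  fixes s :: real
  assumes "s \<ge> 0"
  shows "(1 + s) ^ q \<le> 2 ^ q * (1 + s ^ q)"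
proof -
  have "(1 + s) ^ q \<le> (2 * max 1 s) ^ q" using assms by (intro power_mono) auto
  also have "\<dots> = 2 ^ q * max 1 s ^ q" by (simp add: power_mult_distrib)
  also have "\<dots> \<le> 2 ^ q * (1 + s ^ q)" using assms by (intro mult_left_mono) (auto simp: max_def)
  finally show ?thesis .
qed

text \<open>\<open>b - (1 + \<phi>) a\<close> is the linear eigenfunction for the eigenvalue \<open>-(1 + \<phi>) < 0\<close>, so its second
  moment only accumulates the jump variances.\<close>
lemma second_deviation_le:
  "n \<ge> 1 \<Longrightarrow> measure_pmf.expectation (type_law n) (\<lambda>(a, b). (real b - (1 + phi_t) * real a)\<^sup>2) \<le> 16 * real n"
proof (induction n rule: dec_induct)
  case base
  have "(1 + phi_t) ^ 2 \<le> 2 ^ 2" using phi_t_bounds by (intro power_mono) auto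
  moreover have "(- 1 - phi_t)\<^sup>2 = (1 + phi_t)\<^sup>2" by (simp add: power2_eq_square algebra_simps)
  ultimately show ?case by (simp only: type_law_1) simp
next
  case (step n)
  define p where "p = 1 + phi_t"
  define f where "f = (\<lambda>(a, b). (real b - p * real a)\<^sup>2)"
  have p: "0 < p" "p < 2" "p\<^sup>2 = p + 1"
    using phi_t_bounds phi_t_sq by (auto simp: p_def power2_eq_square algebra_simps)
  \<comment> \<open>For \<open>h = b - p * a\<close> the two jumps are \<open>p\<^sup>2\<close> and
    \<open>-p\<close>, with total drift \<open>-p * h\<close>; squaring adds the jump
    variances.\<close>
  have gen: "urn_gen f (a, b) = - 2 * p * f (a, b) + (p ^ 4 * real a + p\<^sup>2 * real b)" for a b
  proof -
    have 1: "real a * ((real (b + 1) - p * real (a - 1))\<^sup>2) = real a * (real b - p * real a + p\<^sup>2)\<^sup>2"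
      by (cases a) (simp_all add: p(3) algebra_simps)
    have "urn_gen f (a, b) = real a * ((real b - p * real a + p\<^sup>2)\<^sup>2 - (real b - p * real a)\<^sup>2)
        + real b * ((real b - p * real (a + 1))\<^sup>2 - (real b - p * real a)\<^sup>2)"
      unfolding urn_gen_def f_def prod.case right_diff_distrib 1 ..
    then show ?thesis unfolding f_def prod.case of_nat_add of_nat_1 by algebra
  qed
  have "measure_pmf.expectation (type_law (Suc n)) f =
      measure_pmf.expectation (type_law n) (\<lambda>ab. f ab + urn_gen f ab / n)"
    by (rule type_law_Suc[OF step(1)])
  also have "\<dots> \<le> measure_pmf.expectation (type_law n) (\<lambda>ab. f ab + 16)"
  proof (intro integral_mono_AE AE_pmfI integrable_type_law)
    fix ab assume "ab \<in> set_pmf (type_law n)"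
    moreover obtain a b where ab: "ab = (a, b)" by (cases ab)
    ultimately have le: "a + b \<le> n" using type_law_le[OF step(1)] by simp
    \<comment> \<open>The constant 16 comes from \<open>p < 2\<close> together with
      \<open>a + b \<le> n\<close>.\<close>
    have p4: "p ^ 4 \<le> 2 ^ 4" "p ^ 2 \<le> 2 ^ 2" using p by (intro power_mono; simp)+
    have "p ^ 4 * real a + p\<^sup>2 * real b \<le> 16 * real a + 16 * real b"
      using p4 by (intro add_mono mult_right_mono) auto
    also have "\<dots> \<le> 16 * real n" using le by linarith
    finally have "p ^ 4 * real a + p\<^sup>2 * real b \<le> 16 * real n" .
    moreover have "0 \<le> p * f (a, b)" using p by (simp add: f_def)
    ultimately have "urn_gen f ab \<le> 16 * real n" unfolding ab gen by linarith
    then show "f ab + urn_gen f ab / real n \<le> f ab + 16" using step(1) by (simp add: field_simps)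
  qed
  also have "\<dots> = measure_pmf.expectation (type_law n) f + 16"
    by (subst Bochner_Integration.integral_add) (simp_all add: integrable_type_law)
  finally show ?case using step.IH unfolding f_def p_def by simp
qed

text \<open>The map \<open>u\<close> to \<open>iexp u\<close> is 1-Lipschitz, so closeness in mean
  on a common space carries over to characteristic functions.\<close>

lemma char_distr_diff_le:
  fixes X Y :: "'a \<Rightarrow> real"
  assumes "integrable (measure_pmf p) (\<lambda>x. X x - Y x)"
  shows "cmod (char (distr (measure_pmf p) borel X) t - char (distr (measure_pmf p) borel Y) t) \<le>
    \<bar>t\<bar> * measure_pmf.expectation p (\<lambda>x. \<bar>X x - Y x\<bar>)"
proof -
  have ch: "char (distr (measure_pmf p) borel Z) t = (CLINT x|measure_pmf p. iexp (t * Z x))" for Z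
    unfolding char_def by (subst integral_distr) auto
  have int: "complex_integrable (measure_pmf p) (\<lambda>x. iexp (t * Z x))" for Z
    by (intro measure_pmf.integrable_const_bound[of _ 1]) auto
  have "cmod (iexp u - iexp v) \<le> \<bar>u - v\<bar>" for u v :: real
  proof -
    have "iexp u - iexp v = iexp v * (iexp (u - v) - 1)"
      by (simp add: algebra_simps flip: exp_add)
    also have "cmod \<dots> = cmod (iexp (u - v) - 1)" by (simp add: norm_mult)
    also have "\<dots> \<le> \<bar>u - v\<bar>" using iexp_approx1[of "u - v" 0] by simp
    finally show ?thesis .
  qed
  then have le: "cmod (iexp (t * X x) - iexp (t * Y x)) \<le> \<bar>t\<bar> * \<bar>X x - Y x\<bar>" for x
    by (metis abs_mult right_diff_distrib)
  have "cmod (char (distr (measure_pmf p) borel X) t - char (distr (measure_pmf p) borel Y) t) =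
      cmod (CLINT x|measure_pmf p. iexp (t * X x) - iexp (t * Y x))"
    unfolding ch using int by (subst Bochner_Integration.integral_diff) auto
  also have "\<dots> \<le> measure_pmf.expectation p (\<lambda>x. cmod (iexp (t * X x) - iexp (t * Y x)))"
    by (rule integral_norm_bound)
  also have "\<dots> \<le> measure_pmf.expectation p (\<lambda>x. \<bar>t\<bar> * \<bar>X x - Y x\<bar>)"
    by (rule integral_mono[OF integrable_norm[OF Bochner_Integration.integrable_diff[OF int int]]
          integrable_mult_right[OF integrable_abs[OF assms]] le])
  finally show ?thesis by simp
qed

section \<open>Moments of the linear eigenfunction and transfer to the length\<close>

context urn_coeffs
begin

text \<open>The linear eigenfunction for the eigenvalue \<open>\<phi>\<close>, scaled by \<open>c 1\<close> to agree with \<open>a + b\<close> up to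
  a multiple of the other one.\<close>
definition X :: "nat \<times> nat \<Rightarrow> real" where
  "X = (\<lambda>(a, b). real a * c 1 + real b * ((phi_t + 1) * c 1))"

text \<open>This converts polynomial bounds in \<open>a + b\<close> into bounds by powers of
  \<open>X\<close>, whose moments are available by induction.\<close>

lemma X_lower: "c 1 * (real a + real b) \<le> X (a, b)"
proof -
  have "real b * 1 \<le> real b * (phi_t + 1)" using phi_t_bounds by (intro mult_left_mono) auto
  then have "c 1 * (real a + real b) \<le> c 1 * (real a + real b * (phi_t + 1))"
    using c1 phi_t_bounds by (intro mult_left_mono) auto
  then show ?thesis by (simp add: X_def algebra_simps)
qed

text \<open>The expectation of \<open>fact r * g r\<close> is explicit and has the right limit after
  scaling. Its distance to the moment of \<open>X\<close> is controlled by the moment of order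
  \<open>r - 1\<close>, smaller by a factor of order \<open>n powr phi_t\<close> by
  induction.\<close>

lemma X_moment_LIMSEQ:
  "(\<lambda>n. measure_pmf.expectation (type_law n) (\<lambda>ab. X ab ^ r) / real n powr (real r * phi_t)) \<longlonglongrightarrow> mom r"
proof (induction r rule: less_induct)
  case (less r)
  let ?E = "\<lambda>n. measure_pmf.expectation (type_law n)"
  show ?case
  proof (cases r)
    case 0
    have "mom r = 1" by (simp add: mom_def 0 c0)
    then show ?thesis
      by (intro tendsto_eventually eventually_mono[OF eventually_gt_at_top[of 0]]) (simp add: 0)
  next
    case (Suc q)
    define D where "D = (\<lambda>ab. fact r * g r ab - X ab ^ r)"
    have c1pos: "c 1 > 0" using c1 phi_t_bounds by simp
    \<comment> \<open>\<open>X\<close> is the linear form of the leading-term lemma, as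
      \<open>A\<close> and \<open>B\<close> have first coefficients \<open>c 1\<close> and
      \<open>(phi_t + 1) * c 1\<close>.\<close>
    have "poly_bdd q (\<lambda>a b. D (a, b))"
      using fps_nth_power_mult_power_leading[of A B r] c0
      by (simp add: D_def g_def X_def Suc A_def B_def)
    then obtain C where C: "C \<ge> 0" "\<And>a b. \<bar>D (a, b)\<bar> \<le> C * (1 + real a + real b) ^ q"
      by (rule poly_bddE) blast
    define K where "K = C * 2 ^ q"
    have D_le: "\<bar>D ab\<bar> \<le> K * (1 + (1 / c 1) ^ q * X ab ^ q)" for ab
    proof -
      obtain a b where ab: "ab = (a, b)" by (cases ab)
      have s: "real a + real b \<le> 1 / c 1 * X ab" using X_lower[of a b] c1pos by (simp add: ab field_simps)
      have "\<bar>D ab\<bar> \<le> C * (1 + (real a + real b)) ^ q" using C(2)[of a b] by (simp add: ab add.assoc)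
      also have "\<dots> \<le> C * (2 ^ q * (1 + (real a + real b) ^ q))"
        using C by (intro mult_left_mono one_plus_power_le) auto
      also have "\<dots> \<le> C * (2 ^ q * (1 + (1 / c 1 * X ab) ^ q))"
        using C s by (intro mult_left_mono add_left_mono power_mono) auto
      finally show ?thesis by (simp add: K_def power_mult_distrib power_divide mult.assoc)
    qed
    have ED: "\<bar>?E n D\<bar> \<le> K * (1 + (1 / c 1) ^ q * ?E n (\<lambda>ab. X ab ^ q))" for n
    proof -
      have "\<bar>?E n D\<bar> \<le> ?E n (\<lambda>ab. \<bar>D ab\<bar>)" by (rule integral_abs_bound)
      also have "\<dots> \<le> ?E n (\<lambda>ab. K * (1 + (1 / c 1) ^ q * X ab ^ q))"
        by (intro integral_mono integrable_type_law D_le)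
      also have "\<dots> = K * (1 + (1 / c 1) ^ q * ?E n (\<lambda>ab. X ab ^ q))"
        by (subst integral_mult_right_zero, subst Bochner_Integration.integral_add)
          (simp_all add: integrable_type_law)
      finally show ?thesis .
    qed
    have D0: "(\<lambda>n. ?E n D / real n powr (real r * phi_t)) \<longlonglongrightarrow> 0"
    proof (rule Lim_null_comparison)
      have "(\<lambda>n. K * (real n powr (- (real r * phi_t)) + (1 / c 1) ^ q *
            (?E n (\<lambda>ab. X ab ^ q) / real n powr (real q * phi_t)) * real n powr (- phi_t)))
          \<longlonglongrightarrow> K * (0 + (1 / c 1) ^ q * mom q * 0)"
        using phi_t_bounds Suc by (intro tendsto_intros powr_of_nat_LIMSEQ_0 less.IH) auto
      then show "(\<lambda>n. K * (real n powr (- (real r * phi_t)) + (1 / c 1) ^ q *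
            (?E n (\<lambda>ab. X ab ^ q) / real n powr (real q * phi_t)) * real n powr (- phi_t))) \<longlonglongrightarrow> 0"
        by simp
      show "eventually (\<lambda>n. norm (?E n D / real n powr (real r * phi_t)) \<le>
          K * (real n powr (- (real r * phi_t)) + (1 / c 1) ^ q *
            (?E n (\<lambda>ab. X ab ^ q) / real n powr (real q * phi_t)) * real n powr (- phi_t))) sequentially"
      proof (rule eventually_sequentiallyI[of 1])
        fix n :: nat assume n: "n \<ge> 1"
        have pw: "real n powr (real r * phi_t) = real n powr (real q * phi_t) * real n powr phi_t"
          by (simp add: Suc ring_distribs powr_add)
        have "norm (?E n D / real n powr (real r * phi_t)) \<le>
           K * (1 + (1 / c 1) ^ q * ?E n (\<lambda>ab. X ab ^ q)) / real n powr (real r * phi_t)"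
          using divide_right_mono[OF ED[of n], of "real n powr (real r * phi_t)"] by simp
        also have "\<dots> = K * (1 / real n powr (real r * phi_t) + (1 / c 1) ^ q *
            (?E n (\<lambda>ab. X ab ^ q) / real n powr (real r * phi_t)))"
          by (simp add: add_divide_distrib ring_distribs)
        also have "1 / real n powr (real r * phi_t) = real n powr (- (real r * phi_t))"
          by (simp add: powr_minus_divide)
        also have "?E n (\<lambda>ab. X ab ^ q) / real n powr (real r * phi_t) =
            (?E n (\<lambda>ab. X ab ^ q) / real n powr (real q * phi_t)) * real n powr (- phi_t)"
          unfolding pw by (simp add: powr_minus_divide)
        finally show "norm (?E n D / real n powr (real r * phi_t)) \<le>
          K * (real n powr (- (real r * phi_t)) + (1 / c 1) ^ q *
            (?E n (\<lambda>ab. X ab ^ q) / real n powr (real q * phi_t)) * real n powr (- phi_t))"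
          by (simp only: mult.assoc)
      qed
    qed
    have "(\<lambda>n. fact r * c r * ((\<Prod>k=1..<n. 1 + real r * phi_t / real k) / real n powr (real r * phi_t))
        - ?E n D / real n powr (real r * phi_t)) \<longlonglongrightarrow> fact r * c r * (1 / Gamma (real r * phi_t + 1)) - 0"
      using phi_t_bounds by (intro tendsto_diff tendsto_mult_left LIMSEQ_prod_one_plus_div D0) auto
    then have lim: "(\<lambda>n. fact r * c r * ((\<Prod>k=1..<n. 1 + real r * phi_t / real k) / real n powr (real r * phi_t))
        - ?E n D / real n powr (real r * phi_t)) \<longlonglongrightarrow> mom r"
      by (simp add: mom_def)
    show ?thesis
    proof (rule Lim_transform_eventually[OF lim], rule eventually_sequentiallyI[of 1])
      fix n :: nat assume n: "n \<ge> 1"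
      have "?E n (\<lambda>ab. X ab ^ r) = ?E n (\<lambda>ab. fact r * g r ab - D ab)" by (simp add: D_def)
      also have "\<dots> = fact r * ?E n (g r) - ?E n D"
        by (subst Bochner_Integration.integral_diff) (simp_all add: integrable_type_law)
      finally show "fact r * c r * ((\<Prod>k=1..<n. 1 + real r * phi_t / real k) / real n powr (real r * phi_t))
          - ?E n D / real n powr (real r * phi_t) = ?E n (\<lambda>ab. X ab ^ r) / real n powr (real r * phi_t)"
        by (simp add: expectation_g[OF n] diff_divide_distrib)
    qed
  qed
qed

lemma length_diff_LIMSEQ:
  "(\<lambda>n. measure_pmf.expectation (type_law n)
     (\<lambda>(a, b). \<bar>real (a + b) / real n powr phi_t - X (a, b) / real n powr phi_t\<bar>)) \<longlonglongrightarrow> 0"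
proof (rule Lim_null_comparison)
  have "(\<lambda>n. 17 * real n powr (1 / 2 - phi_t)) \<longlonglongrightarrow> 17 * 0"
    using phi_t_bounds by (intro tendsto_mult_left powr_of_nat_LIMSEQ_0) auto
  then show "(\<lambda>n. 17 * real n powr (1 / 2 - phi_t)) \<longlonglongrightarrow> 0" by simp
  show "eventually (\<lambda>n. norm (measure_pmf.expectation (type_law n)
     (\<lambda>(a, b). \<bar>real (a + b) / real n powr phi_t - X (a, b) / real n powr phi_t\<bar>))
     \<le> 17 * real n powr (1 / 2 - phi_t)) sequentially"
  proof (rule eventually_sequentiallyI[of 1])
    fix n :: nat assume n: "n \<ge> 1"
    \<comment> \<open>The threshold balances the two terms of
      \<open>\<bar>h\<bar> \<le> h\<^sup>2 / s + s\<close>: a second moment of at most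
      \<open>16 * n\<close> yields \<open>17 * s\<close> in mean.\<close>
    define s where "s = sqrt (real n)"
    define N where "N = real n powr phi_t"
    have s: "s > 0" "s * s = real n" and N: "N > 0" using n by (simp_all add: s_def N_def)
    have dev: "\<bar>real (a + b) - X (a, b)\<bar> \<le> (real b - (1 + phi_t) * real a)\<^sup>2 / s + s" for a b
    proof -
      define h where "h = real b - (1 + phi_t) * real a"
      \<comment> \<open>The value of \<open>c 1\<close> is exactly the one that removes the growing
        component from \<open>a + b\<close>, leaving a multiple of \<open>h\<close>.\<close>
      have "real (a + b) - X (a, b) = (1 - 3 * phi_t) / 5 * h"
        using phi_t_sq unfolding X_def h_def c1 of_nat_add prod.case power2_eq_square
        by (simp add: field_simps) algebra
      then have "\<bar>real (a + b) - X (a, b)\<bar> = \<bar>(1 - 3 * phi_t) / 5\<bar> * \<bar>h\<bar>" by (simp only: abs_mult)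
      also have "\<dots> \<le> 1 * \<bar>h\<bar>" using phi_t_bounds by (intro mult_right_mono) auto
      also have "\<dots> \<le> h\<^sup>2 / s + s"
      proof (cases "\<bar>h\<bar> \<le> s")
        case True
        then show ?thesis using s by (simp add: add_increasing)
      next
        case False
        then have "\<bar>h\<bar> * s \<le> \<bar>h\<bar> * \<bar>h\<bar>" using s by (intro mult_left_mono) auto
        then have "\<bar>h\<bar> \<le> h\<^sup>2 / s" using s by (simp add: field_simps power2_eq_square)
        then show ?thesis using s by simp
      qed
      finally show ?thesis by (simp add: h_def)
    qed
    let ?E = "measure_pmf.expectation (type_law n)"
    have "?E (\<lambda>(a, b). \<bar>real (a + b) / N - X (a, b) / N\<bar>) \<le>
        ?E (\<lambda>ab. ((case ab of (a, b) \<Rightarrow> (real b - (1 + phi_t) * real a)\<^sup>2) / s + s) / N)"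
    proof (intro integral_mono integrable_type_law)
      fix ab :: "nat \<times> nat"
      obtain a b where ab: "ab = (a, b)" by (cases ab)
      have "\<bar>real (a + b) / N - X (a, b) / N\<bar> = \<bar>real (a + b) - X (a, b)\<bar> / N"
        using N by (simp add: diff_divide_distrib[symmetric])
      also have "\<dots> \<le> ((real b - (1 + phi_t) * real a)\<^sup>2 / s + s) / N"
        using N dev by (intro divide_right_mono) auto
      finally show "(case ab of (a, b) \<Rightarrow> \<bar>real (a + b) / N - X (a, b) / N\<bar>) \<le>
          ((case ab of (a, b) \<Rightarrow> (real b - (1 + phi_t) * real a)\<^sup>2) / s + s) / N" by (simp add: ab)
    qed
    also have "\<dots> = (?E (\<lambda>(a, b). (real b - (1 + phi_t) * real a)\<^sup>2) / s + s) / N"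
      by (subst integral_divide_zero, subst Bochner_Integration.integral_add)
        (simp_all add: integrable_type_law)
    also have "\<dots> \<le> (16 * real n / s + s) / N"
      using second_deviation_le[OF n] s N by (intro divide_right_mono add_right_mono) auto
    also have "16 * real n / s + s = 17 * s" using s by (simp add: field_simps)
    also have "17 * s / N = 17 * real n powr (1 / 2 - phi_t)"
      using n by (simp add: s_def N_def powr_diff powr_half_sqrt)
    finally have le: "?E (\<lambda>(a, b). \<bar>real (a + b) / N - X (a, b) / N\<bar>) \<le> 17 * real n powr (1 / 2 - phi_t)" .
    have "0 \<le> ?E (\<lambda>(a, b). \<bar>real (a + b) / N - X (a, b) / N\<bar>)"
      by (intro integral_nonneg_AE) auto
    then show "norm (?E (\<lambda>(a, b). \<bar>real (a + b) / real n powr phi_t - X (a, b) / real n powr phi_t\<bar>))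
      \<le> 17 * real n powr (1 / 2 - phi_t)" using le by (simp add: N_def)
  qed
qed

text \<open>The rescaled \<open>X\<close> and the rescaled length live on the same chain. Moments
  identify the limit of the former, and their vanishing distance in mean gives the latter the same
  limit by Levy continuity.\<close>

lemma path_len_limit:
  obtains M where "real_distribution M" "\<And>r. integrable M (\<lambda>x. x ^ r)" "\<And>r. (\<integral>x. x ^ r \<partial>M) = mom r"
    "weak_conv_m (\<lambda>n. distr (measure_pmf (path_len n)) borel (\<lambda>k. real k / real n powr phi_t)) M"
proof -
  define \<mu> where "\<mu> n = distr (measure_pmf (type_law n)) borel (\<lambda>ab. X ab / real n powr phi_t)" for n
  define \<nu> where "\<nu> n = distr (measure_pmf (type_law n)) borel (\<lambda>(a, b). real (a + b) / real n powr phi_t)" for n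
  have \<mu>: "real_distribution (\<mu> n)" and \<nu>: "real_distribution (\<nu> n)" for n
    unfolding \<mu>_def \<nu>_def by (auto intro: prob_space.real_distribution_distr[OF prob_space_measure_pmf])
  have int: "integrable (\<mu> n) (\<lambda>x. x ^ r)" for n r
    unfolding \<mu>_def by (subst integrable_distr_eq) (auto intro: integrable_type_law)
  have "(\<lambda>n. \<integral>x. x ^ r \<partial>\<mu> n) \<longlonglongrightarrow> mom r" for r
  proof (rule Lim_transform_eventually[OF X_moment_LIMSEQ], rule eventually_sequentiallyI[of 1])
    fix n :: nat assume n: "n \<ge> 1"
    have "(\<integral>x. x ^ r \<partial>\<mu> n) = measure_pmf.expectation (type_law n) (\<lambda>ab. (X ab / real n powr phi_t) ^ r)"
      unfolding \<mu>_def by (subst integral_distr) auto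
    then show "measure_pmf.expectation (type_law n) (\<lambda>ab. X ab ^ r) / real n powr (real r * phi_t) =
        (\<integral>x. x ^ r \<partial>\<mu> n)"
      using n by (simp add: power_divide powr_power mult.commute)
  qed
  from method_of_moments[OF \<mu> int this mom_small] obtain M where
    M: "real_distribution M" "\<And>r. integrable M (\<lambda>x. x ^ r)" "\<And>r. (\<integral>x. x ^ r \<partial>M) = mom r"
    and ch: "\<And>t. (\<lambda>n. char (\<mu> n) t) \<longlonglongrightarrow> char M t" by metis
  have "weak_conv_m \<nu> M"
  proof (rule levy_continuity[OF \<nu> M(1)])
    fix t
    have "(\<lambda>n. char (\<nu> n) t - char (\<mu> n) t) \<longlonglongrightarrow> 0"
    proof (rule Lim_null_comparison)
      show "(\<lambda>n. \<bar>t\<bar> * measure_pmf.expectation (type_law n)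
          (\<lambda>(a, b). \<bar>real (a + b) / real n powr phi_t - X (a, b) / real n powr phi_t\<bar>)) \<longlonglongrightarrow> 0"
        using tendsto_mult_right_zero[OF length_diff_LIMSEQ] by simp
      show "eventually (\<lambda>n. cmod (char (\<nu> n) t - char (\<mu> n) t) \<le> \<bar>t\<bar> * measure_pmf.expectation (type_law n)
          (\<lambda>(a, b). \<bar>real (a + b) / real n powr phi_t - X (a, b) / real n powr phi_t\<bar>)) sequentially"
      proof (rule always_eventually, rule allI)
        fix n
        show "cmod (char (\<nu> n) t - char (\<mu> n) t) \<le> \<bar>t\<bar> * measure_pmf.expectation (type_law n)
          (\<lambda>(a, b). \<bar>real (a + b) / real n powr phi_t - X (a, b) / real n powr phi_t\<bar>)"
          using char_distr_diff_le[where p = "type_law n" and t = t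
              and X = "\<lambda>(a, b). real (a + b) / real n powr phi_t"
              and Y = "\<lambda>ab. X ab / real n powr phi_t", OF integrable_type_law]
          unfolding \<mu>_def \<nu>_def by (simp add: case_prod_beta')
      qed
    qed
    from tendsto_add[OF this ch[of t]] show "(\<lambda>n. char (\<nu> n) t) \<longlonglongrightarrow> char M t" by simp
  qed
  moreover have "\<nu> = (\<lambda>n. distr (measure_pmf (path_len n)) borel (\<lambda>k. real k / real n powr phi_t))"
    unfolding \<nu>_def path_len_eq map_pmf_rep_eq
    by (subst distr_distr) (auto simp: o_def case_prod_beta')
  ultimately show ?thesis using M by (intro that[of M]) auto
qed

end

text \<open>The clause on \<open>M'\<close> expresses that the limit law is determined by its
  moments; it follows from \<open>mom_small\<close>, whereas existence and convergence come from
  \<open>path_len_limit\<close>.\<close>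

theorem theorem4:
  fixes c :: "nat \<Rightarrow> real"
  assumes c0: "c 0 = 1"
    and c1: "c 1 = (3 + phi_t) / 5"
    and crec: "\<And>r. r \<ge> 2 \<Longrightarrow>
       c r = (1 / (phi_t * real (r - 1) * ((real r + 1) * phi_t + 1))) *
             (\<Sum>k = 1..r - 1. (real k * phi_t + 1) * c k * c (r - k))"
  shows "\<exists>M. real_distribution M \<and>
     (\<forall>r::nat. integrable M (\<lambda>x. x ^ r) \<and>
        (\<integral>x. x ^ r \<partial>M) = fact r * c r / Gamma (real r * phi_t + 1)) \<and>
     (\<forall>M'. real_distribution M' \<longrightarrow>
        (\<forall>r::nat. integrable M' (\<lambda>x. x ^ r) \<and>
           (\<integral>x. x ^ r \<partial>M') = fact r * c r / Gamma (real r * phi_t + 1)) \<longrightarrow> M' = M) \<and>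
     weak_conv_m (\<lambda>n. distr (measure_pmf (path_len n)) borel
                         (\<lambda>k. real k / real n powr phi_t)) M"
proof -
  interpret urn_coeffs c by (rule urn_coeffs.intro[OF c0 c1 crec])
  obtain M where M: "real_distribution M" "\<And>r. integrable M (\<lambda>x. x ^ r)" "\<And>r. (\<integral>x. x ^ r \<partial>M) = mom r"
    "weak_conv_m (\<lambda>n. distr (measure_pmf (path_len n)) borel (\<lambda>k. real k / real n powr phi_t)) M"
    by (rule path_len_limit) blast
  have "M' = M" if "real_distribution M'"
    "\<forall>r::nat. integrable M' (\<lambda>x. x ^ r) \<and> (\<integral>x. x ^ r \<partial>M') = mom r" for M'
    using that M mom_small by (intro moment_determinate[of M' M mom]) auto
  with M show ?thesis unfolding mom_def by blast
qed

end
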